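(* Let $\lambda_0\in(0,\pi)$, $d\in(0,1/2)$, $c_\gamma\in(0,\infty)$, $\phi\in\left((d-\frac12)\pi,(\frac12-d)\pi\right)$, and let $\{X_n\}_{n\in\mathbb{Z}}$ be a real second-order stationary series whose autocovariance function satisfies $$\gamma_X(h)=\big(c_\gamma\cos(\lambda_0h+\phi)+R_\gamma(h)\big)h^{2d-1},\qquad h\ge1,$$ where $$R_\gamma(h)=(L_{1,\gamma}(h)-c_\gamma\cos(\phi))\cos(\lambda_0h)+\operatorname{sign}(-\sin(\phi))\,(L_{2,\gamma}(h)-|c_\gamma\sin(\phi)|)\sin(\lambda_0h),$$ and $L_{1,\gamma},L_{2,\gamma}:(0,\infty)\to(0,\infty)$ are quasi-monotone slowly varying functions at $+\infty$ with $L_{1,\gamma}(x)\to c_\gamma\cos(\phi)\in(0,\infty)$ and, if $\phi\ne0$, $L_{2,\gamma}(x)\to|c_\gamma\sin(\phi)|\in(0,\infty)$ as $x\to+\infty$. Then $X$ has a spectral density $f_X$ of the form $$f_X(\lambda)=\begin{cases}(c_f^-+R_f^-(\lambda_0-\lambda))(\lambda_0-\lambda)^{-2d},&0<\lambda<\lambda_0,\\(c_f^++R_f^+(\lambda-\lambda_0))(\lambda-\lambda_0)^{-2d},&\lambda_0<\lambda<\pi,\end{cases}$$ with $R_f^\pm(x)\to0$ as $x\to0^+$ and $$c_f^\pm=\frac{c_\gamma}{2\pi}\Gamma(2d)\cos(\pi d\mp\phi).$$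
   Context: $\operatorname{sign}(c)=1,0,-1$ for $c>0$, $c=0$, $c<0$. The spectral density convention is $\gamma_X(h)=\int_{-\pi}^{\pi}e^{ih\lambda}f_X(\lambda)\,d\lambda$, with $f_X(\lambda)=\frac{1}{2\pi}\sum_{h=-\infty}^\infty e^{-ih\lambda}\gamma_X(h)$. A slowly varying function $L$ at infinity with values in $(0,\infty)$ is called quasi-monotone if (i) it is of bounded variation on every compact subinterval of $[0,\infty)$, and (ii) for some $\delta>0$, $\int_0^xu^\delta|dL(u)|=O(x^\delta L(x))$ as $x\to\infty$. *)

theory Defs
  imports "HOL-Probability.Probability" "HOL-Library.Landau_Symbols"
begin

definition covariance :: "'a measure \<Rightarrow> ('a \<Rightarrow> real) \<Rightarrow> ('a \<Rightarrow> real) \<Rightarrow> real" where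
  "covariance M Y Z =
     (LINT \<omega>|M. (Y \<omega> - (LINT \<omega>'|M. Y \<omega>')) * (Z \<omega> - (LINT \<omega>'|M. Z \<omega>')))"

definition second_order_stationary :: "'a measure \<Rightarrow> (int \<Rightarrow> 'a \<Rightarrow> real) \<Rightarrow> bool" where
  "second_order_stationary M X \<longleftrightarrow>
     prob_space M \<and>
     (\<forall>n. X n \<in> borel_measurable M) \<and>
     (\<forall>n. integrable M (\<lambda>\<omega>. (X n \<omega>)\<^sup>2)) \<and>
     (\<forall>n. (LINT \<omega>|M. X n \<omega>) = (LINT \<omega>|M. X 0 \<omega>)) \<and>
     (\<forall>n h. covariance M (X (n + h)) (X n) = covariance M (X h) (X 0))"

definition autocovariance :: "'a measure \<Rightarrow> (int \<Rightarrow> 'a \<Rightarrow> real) \<Rightarrow> int \<Rightarrow> real" where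
  "autocovariance M X h = covariance M (X h) (X 0)"

definition spectral_density :: "(int \<Rightarrow> real) \<Rightarrow> (real \<Rightarrow> real) \<Rightarrow> bool" where
  "spectral_density \<gamma> f \<longleftrightarrow>
     (\<forall>\<nu>\<in>{-pi..pi}. 0 \<le> f \<nu>) \<and>
     set_integrable lborel {-pi..pi} f \<and>
     (\<forall>h. complex_of_real (\<gamma> h) =
        (LINT \<nu>:{-pi..pi}|lborel. cis (of_int h * \<nu>) * complex_of_real (f \<nu>)))"

text \<open>The two-sided Fourier series of an autocovariance function is only conditionally
  convergent in the long-memory case; it is summed by symmetric partial sums.\<close>

definition spectral_series_at :: "(int \<Rightarrow> real) \<Rightarrow> real \<Rightarrow> real \<Rightarrow> bool" where
  "spectral_series_at \<gamma> \<nu> s \<longleftrightarrow>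
     (\<lambda>N. 1 / (2 * complex_of_real pi) *
        (\<Sum>h\<in>{- int N..int N}. cis (- (of_int h * \<nu>)) * complex_of_real (\<gamma> h)))
     \<longlonglongrightarrow> complex_of_real s"

definition slowly_varying :: "(real \<Rightarrow> real) \<Rightarrow> bool" where
  "slowly_varying L \<longleftrightarrow>
     (\<forall>x>0. 0 < L x) \<and>
     (\<forall>c>0. ((\<lambda>x. L (c * x) / L x) \<longlongrightarrow> 1) at_top)"

definition variation_sums :: "(real \<Rightarrow> real) \<Rightarrow> real \<Rightarrow> real \<Rightarrow> real set" where
  "variation_sums g a b =
     {\<Sum>K\<in>D. \<bar>g (Sup K) - g (Inf K)\<bar> | D. D division_of {a..b}}"

definition bounded_variation :: "(real \<Rightarrow> real) \<Rightarrow> real \<Rightarrow> real \<Rightarrow> bool" where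
  "bounded_variation g a b \<longleftrightarrow> bdd_above (variation_sums g a b)"

definition total_variation :: "(real \<Rightarrow> real) \<Rightarrow> real \<Rightarrow> real \<Rightarrow> real" where
  "total_variation g a b = Sup (variation_sums g a b)"

text \<open>Riemann--Stieltjes integral of \<open>u\<close> with respect to \<open>g\<close> over \<open>{a..b}\<close>, as the limit of
  Riemann--Stieltjes sums when the mesh tends to 0 (the gauge is constant).\<close>

definition has_RS_integral ::
  "(real \<Rightarrow> real) \<Rightarrow> (real \<Rightarrow> real) \<Rightarrow> real \<Rightarrow> real \<Rightarrow> real \<Rightarrow> bool" where
  "has_RS_integral u g a b i \<longleftrightarrow>
     (\<forall>e>0. \<exists>\<eta>>0. \<forall>p. p tagged_division_of {a..b} \<and> (\<lambda>t. ball t \<eta>) fine p \<longrightarrow>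
        \<bar>(\<Sum>(t, K)\<in>p. u t * (g (Sup K) - g (Inf K))) - i\<bar> < e)"

text \<open>\<open>\<integral>\<^sub>0\<^sup>x u\<^sup>\<delta> |dL(u)|\<close> is the Stieltjes integral against the total variation function of \<open>L\<close>;
  it exists whenever \<open>L\<close> is of bounded variation on \<open>{0..x}\<close>.
  For \<open>L\<close> given on \<open>(0,\<infinity>)\<close> only, the value \<open>L 0\<close> is immaterial: neither condition depends
  on it, since it changes variations by a finite amount and \<open>u\<^sup>\<delta>\<close> is continuous with value 0
  at 0.\<close>

definition quasi_monotone :: "(real \<Rightarrow> real) \<Rightarrow> bool" where
  "quasi_monotone L \<longleftrightarrow>
     slowly_varying L \<and>
     (\<forall>a b. 0 \<le> a \<and> a \<le> b \<longrightarrow> bounded_variation L a b) \<and>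
     (\<exists>\<delta>>0. \<exists>I.
        (\<forall>x>0. has_RS_integral (\<lambda>u. u powr \<delta>) (total_variation L 0) 0 x (I x)) \<and>
        I \<in> O[at_top](\<lambda>x. x powr \<delta> * L x))"

end

(*
Write a = 2d. The autocovariance is the real part of m_h h^(a-1) cis(-nu_0 h) with m_h complex,
so the spectral series is governed by F(z) = sum_h m_h h^(a-1) z^h on the unit circle, taken at
z = cis(nu - nu_0) and z = cis(-(nu + nu_0)). Quasi-monotonicity enters only through the bound
sum_{N<=h<2N} |m_{h+1} - m_h| = O(1); by summation by parts it makes the tails of F beyond M of
order M^(a-1)/|1-z|. Cutting at M ~ 1/|1-z| gives |F(z)| = O(|1-z|^(-a)), uniformly for partial
sums, and o(|1-z|^(-a)) when m_h -> 0. Subtracting a multiple of the binomial series of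
(1-z)^(-a), whose coefficients are ~ h^(a-1)/Gamma(a), reduces the singularity at nu_0 to this
last case. Positivity of f comes from Fejer sums, which are quadratic forms in the
autocovariances, and the Fourier coefficients from dominated convergence.
*)
theory Submission
  imports Defs
begin

subsection \<open>Power sums with dyadically bounded variation\<close>

text \<open>Since h^(a-1) is not summable, absolute values can serve only below the cut; above it
  the oscillation of z^h must be used. The coefficients m_h need not be monotone and their total
  variation over all h may be infinite. The block bound suffices because, weighted by h^(a-1), the
  dyadic blocks form a geometric series of ratio 2^(a-1).

  The constants arise as follows. The limit of m_h is
  \<open>c\<^sub>\<gamma> * cis (- \<phi>)\<close>. Near x = 0+, 1 - cis(s x) behaves like -i s x
  for s = 1 or s = -1, and the power -a turns this into x^(-a) cis(s pi a/2). With a = 2d, the real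
  part of the product of the limit, Gamma(2d) and cis(s pi d) is a cosine of s pi d - \<phi>, so the
  two signs s give the two one-sided constants.

  The singularities at \<open>\<nu>\<^sub>0\<close> and \<open>- \<nu>\<^sub>0\<close> do not
  interfere: near \<open>\<nu>\<^sub>0\<close> the second argument stays away from the multiples of
  2 pi. Bounds uniform in the length of the partial sums are wanted because they yield the majorant
  of dominated convergence, a sum of powers \<open>\<bar>x\<bar> powr (- a)\<close>, integrable as a
  < 1.\<close>

lemma summation_by_parts:
  fixes b :: "nat \<Rightarrow> 'a::comm_ring_1"
  assumes "M \<le> N"
  shows "(1 - z) * (\<Sum>h=M..<N. b h * z ^ h) =
    b M * z ^ M - b N * z ^ N + (\<Sum>h=M..<N. (b (Suc h) - b h) * z ^ Suc h)"
  using assms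
proof (induction N rule: dec_induct)
  case (step n)
  have "(1 - z) * (\<Sum>h=M..<Suc n. b h * z ^ h) =
      (1 - z) * (\<Sum>h=M..<n. b h * z ^ h) + (1 - z) * (b n * z ^ n)"
    using step.hyps by (simp add: distrib_left)
  also have "\<dots> = b M * z ^ M - b (Suc n) * z ^ Suc n +
      ((\<Sum>h=M..<n. (b (Suc h) - b h) * z ^ Suc h) + (b (Suc n) - b n) * z ^ Suc n)"
    unfolding step.IH by (simp add: algebra_simps)
  also have "(\<Sum>h=M..<n. (b (Suc h) - b h) * z ^ Suc h) + (b (Suc n) - b n) * z ^ Suc n =
      (\<Sum>h=M..<Suc n. (b (Suc h) - b h) * z ^ Suc h)"
    using step.hyps by simp
  finally show ?case .
qed simp

text \<open>The upper boundary term \<open>b N\<close> differs from \<open>b M\<close> by at most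
  the variation, so it can be absorbed. This leaves a bound in terms of the starting value and the
  variation alone, at the price of the factor 2.\<close>

lemma norm_power_sum_le:
  fixes b :: "nat \<Rightarrow> 'a::real_normed_field"
  assumes "M \<le> N" and z: "norm z = 1" "z \<noteq> 1"
  shows "norm (\<Sum>h=M..<N. b h * z ^ h) \<le>
    2 * (norm (b M) + (\<Sum>h=M..<N. norm (b (Suc h) - b h))) / norm (1 - z)"
proof -
  define V where "V = (\<Sum>h=M..<N. norm (b (Suc h) - b h))"
  have "norm (b N - b M) \<le> V"
    unfolding V_def sum_Suc_diff'[OF assms(1), symmetric] by (rule norm_sum)
  then have bN: "norm (b N) \<le> norm (b M) + V"
    using norm_triangle_sub[of "b N" "b M"] by linarith
  have "norm (\<Sum>h=M..<N. (b (Suc h) - b h) * z ^ Suc h) \<le> V"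
    unfolding V_def by (rule sum_norm_le) (simp add: norm_mult norm_power z del: power_Suc)
  moreover have "norm (b M * z ^ M - b N * z ^ N) \<le> norm (b M) + norm (b N)"
    using norm_triangle_ineq4[of "b M * z ^ M" "b N * z ^ N"] by (simp add: norm_mult norm_power z)
  ultimately have "norm ((1 - z) * (\<Sum>h=M..<N. b h * z ^ h)) \<le> norm (b M) + norm (b N) + V"
    unfolding summation_by_parts[OF assms(1)] by (intro norm_triangle_mono)
  also have "\<dots> \<le> 2 * (norm (b M) + V)" using bN by simp
  finally have "norm ((1 - z) * (\<Sum>h=M..<N. b h * z ^ h)) \<le> 2 * (norm (b M) + V)" .
  moreover have "norm (1 - z) > 0" using z by simp
  ultimately show ?thesis
    unfolding V_def[symmetric] norm_mult by (simp only: pos_le_divide_eq mult.commute)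
qed

text \<open>On the block from M to 2M the decreasing weight is at most M^(a-1), and passing to the
  next block multiplies this by \<rho> = 2^(a-1) < 1. The geometric series gives 1/(1 - \<rho>). The
  induction removes one block at a time.\<close>

lemma dyadic_sum_le:
  fixes v :: "nat \<Rightarrow> real"
  assumes a: "a < 1" and v: "\<And>h. 0 \<le> v h"
    and K: "\<And>N. N \<ge> 1 \<Longrightarrow> (\<Sum>h=N..<2*N. v h) \<le> K"
    and M: "M \<ge> 1"
  shows "(\<Sum>h=M..<N. v h * real h powr (a - 1)) \<le> K * real M powr (a - 1) / (1 - 2 powr (a - 1))"
  using M
proof (induction "N - M" arbitrary: M rule: less_induct)
  case less
  define \<rho> :: real where "\<rho> = 2 powr (a - 1)"
  have \<rho>: "0 < \<rho>" "\<rho> < 1" using a by (auto simp: \<rho>_def powr_less_one)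
  have K0: "0 \<le> K" using K[of 1] v by (meson le_refl order_trans sum_nonneg)
  have block: "(\<Sum>h=M..<N'. v h * real h powr (a - 1)) \<le> K * real M powr (a - 1)"
    if "N' \<le> 2 * M" for N'
  proof -
    have "(\<Sum>h=M..<N'. v h * real h powr (a - 1)) \<le> (\<Sum>h=M..<N'. v h * real M powr (a - 1))"
      using less.prems a v by (intro sum_mono mult_left_mono powr_mono2') auto
    also have "\<dots> = (\<Sum>h=M..<N'. v h) * real M powr (a - 1)" by (simp add: sum_distrib_right)
    also have "\<dots> \<le> K * real M powr (a - 1)"
      using sum_mono2[of "{M..<2*M}" "{M..<N'}" v] that v K[OF less.prems]
      by (intro mult_right_mono) auto
    finally show ?thesis .
  qed
  show ?case
  proof (cases "N \<le> 2 * M")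
    case True
    have "K * real M powr (a - 1) \<le> K * real M powr (a - 1) / (1 - \<rho>)"
      using \<rho> K0 by (simp add: field_simps)
    with block[OF True] show ?thesis by (simp add: \<rho>_def)
  next
    case False
    have "(\<Sum>h=M..<N. v h * real h powr (a - 1)) =
        (\<Sum>h=M..<2*M. v h * real h powr (a - 1)) + (\<Sum>h=2*M..<N. v h * real h powr (a - 1))"
      using False by (simp add: sum.atLeastLessThan_concat)
    also have "\<dots> \<le> K * real M powr (a - 1) + K * real (2 * M) powr (a - 1) / (1 - \<rho>)"
      unfolding \<rho>_def using False less.prems by (intro add_mono block less.hyps) auto
    also have "\<dots> = K * real M powr (a - 1) / (1 - \<rho>)"
      using \<rho> by (simp add: powr_mult \<rho>_def[symmetric] field_simps)
    finally show ?thesis by (simp add: \<rho>_def)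
  qed
qed

text \<open>A scale-invariant condition: the variation over [1, N] may grow like log N. It is weak
  enough to follow from quasi-monotonicity together with convergence, and strong enough for weights
  that decay like a negative power.\<close>

definition dyadic_bv :: "(nat \<Rightarrow> 'a::real_normed_vector) \<Rightarrow> bool" where
  "dyadic_bv m \<longleftrightarrow> (\<exists>K. \<forall>N\<ge>1. (\<Sum>h=N..<2*N. norm (m (Suc h) - m h)) \<le> K)"

text \<open>The difference of the products m_h h^(a-1) has two parts: the difference of m_h times a
  weight, summed over dyadic blocks, and a bounded factor times the difference of weights, which
  telescopes by monotonicity. The start M >= 1 matters: \<open>0 powr (a - 1)\<close> is 0, so the
  weights are decreasing only from index 1 on.\<close>

lemma tail_power_sum_bound:
  fixes m :: "nat \<Rightarrow> complex"
  assumes a: "a < 1" and B: "\<And>h. norm (m h) \<le> B" and bv: "dyadic_bv m"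
  obtains C where "0 < C" and
    "\<And>M N z. 1 \<le> M \<Longrightarrow> norm z = 1 \<Longrightarrow> z \<noteq> 1 \<Longrightarrow>
      norm (\<Sum>h=M..<N. m h * of_real (real h powr (a - 1)) * z ^ h)
        \<le> C * real M powr (a - 1) / norm (1 - z)"
proof -
  obtain K where K: "\<And>N. N \<ge> 1 \<Longrightarrow> (\<Sum>h=N..<2*N. norm (m (Suc h) - m h)) \<le> K"
    using bv unfolding dyadic_bv_def by blast
  \<comment> \<open>The summand 1 makes C strictly positive even when B and K vanish.\<close>
  define C where "C = 1 + 2 * (2 * B + K / (1 - 2 powr (a - 1)))"
  define b where "b = (\<lambda>h. m h * complex_of_real (real h powr (a - 1)))"
  have B0: "0 \<le> B" using B[of 0] norm_ge_zero order_trans by blast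
  have "0 \<le> K" using K[of 1] by (meson le_refl norm_ge_zero order_trans sum_nonneg)
  moreover have "2 powr (a - 1) < (1::real)" using a by (simp add: powr_less_one)
  ultimately have C: "0 < C" using B0 by (auto simp: C_def intro!: add_pos_nonneg)
  have var: "(\<Sum>h=M..<N. norm (b (Suc h) - b h))
      \<le> (B + K / (1 - 2 powr (a - 1))) * real M powr (a - 1)" if M: "1 \<le> M" "M \<le> N" for M N
  proof -
    have "norm (b (Suc h) - b h) \<le> norm (m (Suc h) - m h) * real h powr (a - 1)
        + B * (real h powr (a - 1) - real (Suc h) powr (a - 1))" if h: "h \<in> {M..<N}" for h
    proof -
      have mono: "real (Suc h) powr (a - 1) \<le> real h powr (a - 1)"
        using h M a by (intro powr_mono2') auto
      have "b (Suc h) - b h = (m (Suc h) - m h) * of_real (real h powr (a - 1))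
          - m (Suc h) * of_real (real h powr (a - 1) - real (Suc h) powr (a - 1))"
        by (simp add: b_def algebra_simps)
      also have "norm \<dots> \<le> norm (m (Suc h) - m h) * real h powr (a - 1)
          + norm (m (Suc h)) * (real h powr (a - 1) - real (Suc h) powr (a - 1))"
        using mono by (intro order_trans[OF norm_triangle_ineq4]) (simp add: norm_mult del: of_real_diff)
      also have "\<dots> \<le> norm (m (Suc h) - m h) * real h powr (a - 1)
          + B * (real h powr (a - 1) - real (Suc h) powr (a - 1))"
        using mono B by (intro add_left_mono mult_right_mono) auto
      finally show ?thesis .
    qed
    then have "(\<Sum>h=M..<N. norm (b (Suc h) - b h)) \<le>
        (\<Sum>h=M..<N. norm (m (Suc h) - m h) * real h powr (a - 1)
          + B * (real h powr (a - 1) - real (Suc h) powr (a - 1)))"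
      by (rule sum_mono)
    also have "\<dots> = (\<Sum>h=M..<N. norm (m (Suc h) - m h) * real h powr (a - 1))
        + B * (real M powr (a - 1) - real N powr (a - 1))"
      using sum_Suc_diff'[OF M(2), of "\<lambda>h. - (real h powr (a - 1))"]
      by (simp add: sum.distrib sum_distrib_left[symmetric] del: of_nat_Suc)
    also have "\<dots> \<le> K * real M powr (a - 1) / (1 - 2 powr (a - 1)) + B * real M powr (a - 1)"
      using a K M B0 by (intro add_mono dyadic_sum_le mult_left_mono) auto
    finally show ?thesis by (simp add: algebra_simps)
  qed
  have "norm (\<Sum>h=M..<N. b h * z ^ h) \<le> C * real M powr (a - 1) / norm (1 - z)"
    if M: "1 \<le> M" and z: "norm z = 1" "z \<noteq> 1" for M N z
  proof (cases "M \<le> N")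
    case True
    have "norm (b M) \<le> B * real M powr (a - 1)"
      using B by (auto simp: b_def norm_mult intro!: mult_right_mono)
    then have "2 * (norm (b M) + (\<Sum>h=M..<N. norm (b (Suc h) - b h)))
        \<le> 2 * (B * real M powr (a - 1) + (B + K / (1 - 2 powr (a - 1))) * real M powr (a - 1))"
      using var[OF M True] by (intro mult_left_mono add_mono) auto
    also have "\<dots> = (C - 1) * real M powr (a - 1)"
      by (simp add: C_def distrib_left distrib_right)
    also have "\<dots> \<le> C * real M powr (a - 1)" by (intro mult_right_mono) auto
    finally have "2 * (norm (b M) + (\<Sum>h=M..<N. norm (b (Suc h) - b h))) \<le> C * real M powr (a - 1)" .
    then show ?thesis
      using norm_power_sum_le[OF True z, of b] z
      by (meson divide_right_mono norm_ge_zero order_trans)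
  next
    case False
    then show ?thesis using C by simp
  qed
  with C show ?thesis by (intro that[of C]) (auto simp: b_def)
qed

section \<open>Series with coefficients m_h h^(a-1) on the unit circle\<close>

lemma sum_powr_le:
  fixes a :: real
  assumes a: "0 < a" "a < 1"
  shows "(\<Sum>h<Suc N. real h powr (a - 1)) \<le> real N powr a / a"
proof (induction N)
  case (Suc N)
  \<comment> \<open>Comparison with the increment of x^a, whose derivative a x^(a-1) is decreasing.
    The case N = 0 is separate, because x^a is not differentiable at 0.\<close>
  have "a * real (Suc N) powr (a - 1) \<le> real (Suc N) powr a - real N powr a"
  proof (cases "N = 0")
    case False
    have "\<exists>x>real N. x < real (Suc N) \<and>
        real (Suc N) powr a - real N powr a = (real (Suc N) - real N) * (a * x powr (a - 1))"
      using False by (intro MVT2) (auto intro!: derivative_eq_intros)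
    then obtain x where x: "real N < x" "x < real (Suc N)"
        "real (Suc N) powr a - real N powr a = a * x powr (a - 1)" by auto
    have "real (Suc N) powr (a - 1) \<le> x powr (a - 1)"
      using x a by (intro powr_mono2') auto
    then show ?thesis using x(3) a by simp
  qed (use a in simp)
  with Suc a show ?case by (simp add: field_simps)
qed simp

text \<open>By the convention \<open>0 powr y = 0\<close>, the coefficient of index 0 is 0 whatever
  \<open>m 0\<close> is; the variance term is therefore added separately later.\<close>

definition weighted :: "real \<Rightarrow> (nat \<Rightarrow> complex) \<Rightarrow> nat \<Rightarrow> complex" where
  "weighted a m h = m h * of_real (real h powr (a - 1))"

lemma norm_weighted: "norm (weighted a m h) = norm (m h) * real h powr (a - 1)"
  by (simp add: weighted_def norm_mult)

text \<open>For fixed z the finite tail bound tends to 0 like M^(a-1), which is Cauchy's criterion;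
  letting the upper end go to infinity then bounds the remainder. One constant C serves all z, so
  the dependence on z is entirely in the denominator.\<close>

lemma weighted_tail:
  assumes a: "a < 1" and B: "\<And>h. norm (m h) \<le> B" and bv: "dyadic_bv m"
  obtains C where "0 < C" and
    "\<And>z. norm z = 1 \<Longrightarrow> z \<noteq> 1 \<Longrightarrow> summable (\<lambda>h. weighted a m h * z ^ h)"
    "\<And>M N z. 1 \<le> M \<Longrightarrow> norm z = 1 \<Longrightarrow> z \<noteq> 1 \<Longrightarrow>
      norm (\<Sum>h=M..<N. weighted a m h * z ^ h) \<le> C * real M powr (a - 1) / norm (1 - z)"
    "\<And>M z. 1 \<le> M \<Longrightarrow> norm z = 1 \<Longrightarrow> z \<noteq> 1 \<Longrightarrow>
      norm ((\<Sum>h. weighted a m h * z ^ h) - (\<Sum>h<M. weighted a m h * z ^ h))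
        \<le> C * real M powr (a - 1) / norm (1 - z)"
proof -
  obtain C where C: "0 < C"
    and tail: "\<And>M N z. 1 \<le> M \<Longrightarrow> norm z = 1 \<Longrightarrow> z \<noteq> 1 \<Longrightarrow>
      norm (\<Sum>h=M..<N. weighted a m h * z ^ h) \<le> C * real M powr (a - 1) / norm (1 - z)"
    using tail_power_sum_bound[OF a B bv] unfolding weighted_def by blast
  have summ: "summable (\<lambda>h. weighted a m h * z ^ h)" if z: "norm z = 1" "z \<noteq> 1" for z
    unfolding summable_Cauchy
  proof (intro allI impI)
    fix e :: real assume "0 < e"
    have "(\<lambda>M. C * real M powr (a - 1) / norm (1 - z)) \<longlonglongrightarrow> C * 0 / norm (1 - z)"
      using a z by (intro tendsto_intros tendsto_neg_powr filterlim_real_sequentially) auto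
    then have "eventually (\<lambda>M. C * real M powr (a - 1) / norm (1 - z) < e) sequentially"
      using \<open>0 < e\<close> by (auto dest!: order_tendstoD(2))
    then obtain N where N: "\<And>M. M \<ge> N \<Longrightarrow> C * real M powr (a - 1) / norm (1 - z) < e"
      unfolding eventually_sequentially by blast
    show "\<exists>N. \<forall>k\<ge>N. \<forall>n. norm (\<Sum>h=k..<n. weighted a m h * z ^ h) < e"
      using N tail[OF _ z] by (intro exI[of _ "max 1 N"]) (auto intro: le_less_trans)
  qed
  have "norm ((\<Sum>h. weighted a m h * z ^ h) - (\<Sum>h<M. weighted a m h * z ^ h))
        \<le> C * real M powr (a - 1) / norm (1 - z)"
    if M: "1 \<le> M" and z: "norm z = 1" "z \<noteq> 1" for M z
  proof (rule tendsto_upperbound)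
    show "(\<lambda>N. norm ((\<Sum>h<N. weighted a m h * z ^ h) - (\<Sum>h<M. weighted a m h * z ^ h)))
        \<longlonglongrightarrow> norm ((\<Sum>h. weighted a m h * z ^ h) - (\<Sum>h<M. weighted a m h * z ^ h))"
      by (intro tendsto_intros summable_LIMSEQ summ z)
    show "\<forall>\<^sub>F N in sequentially. norm ((\<Sum>h<N. weighted a m h * z ^ h) - (\<Sum>h<M. weighted a m h * z ^ h))
        \<le> C * real M powr (a - 1) / norm (1 - z)"
      using eventually_ge_at_top[of M]
    proof eventually_elim
      case (elim N)
      have "(\<Sum>h<N. weighted a m h * z ^ h) - (\<Sum>h<M. weighted a m h * z ^ h)
          = (\<Sum>h=M..<N. weighted a m h * z ^ h)"
        using sum_diff_nat_ivl[of 0 M N "\<lambda>h. weighted a m h * z ^ h"] elim by (simp add: lessThan_atLeast0)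
      then show ?case using tail[OF M z] by simp
    qed
  qed simp
  with C summ tail that show thesis by blast
qed

lemma weighted_head:
  assumes a: "0 < a" "a < 1" and B: "\<And>h. norm (m h) \<le> B"
  shows "(\<Sum>h<N. norm (weighted a m h)) \<le> B / a * real N powr a"
proof -
  have "0 \<le> B" using B[of 0] norm_ge_zero order_trans by blast
  have "(\<Sum>h<N. norm (weighted a m h)) \<le> (\<Sum>h<Suc N. norm (weighted a m h))" by simp
  also have "\<dots> \<le> (\<Sum>h<Suc N. B * real h powr (a - 1))"
    unfolding norm_weighted by (intro sum_mono mult_right_mono B) auto
  also have "\<dots> \<le> B * (real N powr a / a)"
    unfolding sum_distrib_left[symmetric] by (intro mult_left_mono sum_powr_le a \<open>0 \<le> B\<close>)
  finally show ?thesis by simp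
qed

lemma weighted_partial_sum_bound:
  assumes a: "0 < a" "a < 1" and B: "\<And>h. norm (m h) \<le> B" and bv: "dyadic_bv m"
  obtains C where "0 \<le> C" and
    "\<And>N z. norm z = 1 \<Longrightarrow> z \<noteq> 1 \<Longrightarrow>
      norm (\<Sum>h<N. weighted a m h * z ^ h) \<le> C * norm (1 - z) powr (- a)"
proof -
  obtain C where C: "0 < C"
    and tail: "\<And>M N z. 1 \<le> M \<Longrightarrow> norm z = 1 \<Longrightarrow> z \<noteq> 1 \<Longrightarrow>
      norm (\<Sum>h=M..<N. weighted a m h * z ^ h) \<le> C * real M powr (a - 1) / norm (1 - z)"
    using weighted_tail[OF a(2) B bv] by metis
  have B0: "0 \<le> B" using B[of 0] norm_ge_zero order_trans by blast
  have "norm (\<Sum>h<N. weighted a m h * z ^ h) \<le> (B / a * 4 powr a + C * 2 powr (a - 1)) * norm (1 - z) powr (- a)"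
    if z: "norm z = 1" "z \<noteq> 1" for N z
  proof -
    define q where "q = norm (1 - z)"
    have q: "0 < q" "q \<le> 2" using z norm_triangle_ineq4[of 1 z] by (auto simp: q_def)
    \<comment> \<open>With M of order 1/q, the head M^a and the tail M^(a-1)/q both have order
      q^(-a). The numerator 2 is used because q <= 2: then 2/q >= 1, and rounding up stays below
      4/q.\<close>
    define M where "M = nat \<lceil>2 / q\<rceil>"
    have M: "2 / q \<le> real M" "real M \<le> 4 / q"
    proof -
      show "2 / q \<le> real M" unfolding M_def by linarith
      have "real M \<le> 2 / q + 1" using q unfolding M_def
        by (smt (verit) divide_pos_pos of_nat_nat of_int_ceiling_le_add_one zero_less_ceiling)
      also have "\<dots> \<le> 4 / q" using q by (simp add: field_simps)
      finally show "real M \<le> 4 / q" .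
    qed
    have M1: "1 \<le> M" using q M by (metis Suc_leI One_nat_def divide_pos_pos less_le_trans of_nat_0_less_iff zero_less_numeral)
    have head: "norm (\<Sum>h<n. weighted a m h * z ^ h) \<le> B / a * 4 powr a * q powr (- a)" if "n \<le> M" for n
    proof -
      have "norm (\<Sum>h<n. weighted a m h * z ^ h) \<le> (\<Sum>h<n. norm (weighted a m h))"
        by (rule sum_norm_le) (simp add: norm_mult norm_power z)
      also have "\<dots> \<le> B / a * real n powr a" by (rule weighted_head[OF a B])
      also have "\<dots> \<le> B / a * (4 / q) powr a"
        using B0 a M that by (intro mult_left_mono powr_mono2) auto
      also have "\<dots> = B / a * 4 powr a * q powr (- a)"
        using q by (simp add: powr_divide powr_minus_divide)
      finally show ?thesis .
    qed
    have nn: "0 \<le> C * 2 powr (a - 1) * q powr (- a)" using C by simp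
    show ?thesis
    proof (cases "N \<le> M")
      case True
      then show ?thesis using head[OF True] nn by (simp add: distrib_right q_def)
    next
      case False
      then have "(\<Sum>h<N. weighted a m h * z ^ h) =
          (\<Sum>h<M. weighted a m h * z ^ h) + (\<Sum>h=M..<N. weighted a m h * z ^ h)"
        using sum.atLeastLessThan_concat[of 0 M N "\<lambda>h. weighted a m h * z ^ h"] by (simp add: lessThan_atLeast0)
      also have "norm \<dots> \<le> B / a * 4 powr a * q powr (- a) + C * real M powr (a - 1) / q"
        using tail[OF M1 z] head[of M] unfolding q_def by (intro norm_triangle_mono) auto
      also have "C * real M powr (a - 1) / q \<le> C * (2 / q) powr (a - 1) / q"
        using C q M a by (intro divide_right_mono mult_left_mono powr_mono2') auto
      also have "\<dots> = C * 2 powr (a - 1) * q powr (- a)"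
        using q by (simp add: powr_divide powr_minus_divide powr_diff)
      finally show ?thesis by (simp add: distrib_right q_def)
    qed
  qed
  then show ?thesis using C B0 a that[of "B / a * 4 powr a + C * 2 powr (a - 1)"] by auto
qed

text \<open>Below some H the coefficients are merely bounded, which costs a constant; beyond H they
  are smaller than a e, and this factor a cancels the 1/a of the general head estimate.\<close>

lemma weighted_head_small:
  assumes a: "0 < a" "a < 1" and B: "\<And>h. norm (m h) \<le> B" and lim: "m \<longlonglongrightarrow> 0" and e: "0 < e"
  obtains K where "0 \<le> K" "\<And>N. (\<Sum>h<N. norm (weighted a m h)) \<le> K + e * real N powr a"
proof -
  obtain H where H: "\<And>h. h \<ge> H \<Longrightarrow> norm (m h) < a * e"
    using LIMSEQ_D[OF lim, of "a * e"] a e by auto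
  have B0: "0 \<le> B" using B[of 0] norm_ge_zero order_trans by blast
  define m1 where "m1 h = (if h < H then 0 else m h)" for h
  have "(\<Sum>h<N. norm (weighted a m h)) \<le> B * real H + e * real N powr a" for N
  proof -
    have "norm (weighted a m h) \<le> (if h < H then B else 0) + norm (weighted a m1 h)" for h
    proof (cases "h < H")
      case True
      have "real h powr (a - 1) \<le> 1"
        using a powr_mono[of "a - 1" 0 "real h"] by (cases "h = 0") auto
      then have "norm (m h) * real h powr (a - 1) \<le> B * 1" using B B0 by (intro mult_mono) auto
      with True show ?thesis by (simp add: norm_weighted m1_def)
    qed (simp add: norm_weighted m1_def)
    then have "(\<Sum>h<N. norm (weighted a m h)) \<le> (\<Sum>h<N. if h < H then B else 0) + (\<Sum>h<N. norm (weighted a m1 h))"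
      unfolding sum.distrib[symmetric] by (intro sum_mono)
    also have "(\<Sum>h<N. if h < H then B else 0) \<le> (\<Sum>h<N + H. if h < H then B else 0)"
      using B0 by (intro sum_mono2) auto
    also have "\<dots> = B * real H"
    proof -
      have "{..<N + H} \<inter> {h. h < H} = {..<H}" by auto
      then show ?thesis by (simp add: sum.If_cases mult.commute)
    qed
    also have "(\<Sum>h<N. norm (weighted a m1 h)) \<le> (a * e) / a * real N powr a"
      using a e H by (intro weighted_head) (auto simp: m1_def less_imp_le)
    finally show ?thesis using a by simp
  qed
  with B0 show ?thesis by (intro that[of "B * real H"]) auto
qed

text \<open>Cutting at a fixed multiple of 1/|1-z| would make only the head small. The cut is
  therefore at A/|1-z| with A large, which makes the tail a small multiple of |1-z|^(-a), because
  the exponent a - 1 is negative.\<close>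

lemma weighted_series_small:
  assumes a: "0 < a" "a < 1" and B: "\<And>h. norm (m h) \<le> B" and bv: "dyadic_bv m"
    and lim: "m \<longlonglongrightarrow> 0"
  shows "((\<lambda>z. norm (1 - z) powr a * norm (\<Sum>h. weighted a m h * z ^ h)) \<longlongrightarrow> 0) (at 1 within sphere 0 1)"
proof (rule tendstoI)
  fix e :: real assume e: "0 < e"
  obtain C where C: "0 < C"
    and tail: "\<And>M z. 1 \<le> M \<Longrightarrow> norm z = 1 \<Longrightarrow> z \<noteq> 1 \<Longrightarrow>
      norm ((\<Sum>h. weighted a m h * z ^ h) - (\<Sum>h<M. weighted a m h * z ^ h))
        \<le> C * real M powr (a - 1) / norm (1 - z)"
    using weighted_tail[OF a(2) B bv] by metis
  have "((\<lambda>A. C * A powr (a - 1)) \<longlongrightarrow> C * 0) at_top"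
    using a by (intro tendsto_intros tendsto_neg_powr filterlim_ident) auto
  from order_tendstoD(2)[OF this, of "e / 3"] e
  have "eventually (\<lambda>A. C * A powr (a - 1) < e / 3) at_top" by simp
  then obtain A where A: "0 < A" "C * A powr (a - 1) < e / 3"
    using eventually_happens'[OF trivial_limit_at_top_linorder eventually_conj[OF eventually_gt_at_top]]
    by blast
  \<comment> \<open>This choice follows that of A: inserting the cut M <= (A + 1)/q into the second
    summand leaves exactly e/3 times q^(-a). The constant K is harmless, since it gets multiplied by
    q^a.\<close>
  obtain K where K: "0 \<le> K" "\<And>N. (\<Sum>h<N. norm (weighted a m h)) \<le> K + e / (3 * (A + 1) powr a) * real N powr a"
    using weighted_head_small[OF a B lim, of "e / (3 * (A + 1) powr a)"] e A by auto
  have "((\<lambda>z::complex. norm (1 - z)) \<longlongrightarrow> norm (1 - 1 :: complex)) (at 1 within sphere 0 1)"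
    by (intro tendsto_intros)
  then have q0: "((\<lambda>z::complex. norm (1 - z)) \<longlongrightarrow> 0) (at 1 within sphere 0 1)" by simp
  have "((\<lambda>z::complex. norm (1 - z) powr a * K) \<longlongrightarrow> 0 powr a * K) (at 1 within sphere 0 1)"
    using a by (intro tendsto_intros q0 tendsto_powr2) auto
  from order_tendstoD(2)[OF this, of "e / 3"] e a
  have "\<forall>\<^sub>F z in at (1::complex) within sphere 0 1. norm (1 - z) powr a * K < e / 3" by simp
  moreover have "\<forall>\<^sub>F z in at (1::complex) within sphere 0 1. norm (1 - z) < 1"
    using q0 by (auto dest!: order_tendstoD(2))
  moreover have "\<forall>\<^sub>F z in at (1::complex) within sphere 0 1. z \<in> sphere 0 1 \<and> z \<noteq> 1"
    by (auto simp: eventually_at_filter)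
  ultimately show "\<forall>\<^sub>F z in at 1 within sphere 0 1.
      dist (norm (1 - z) powr a * norm (\<Sum>h. weighted a m h * z ^ h)) 0 < e"
  proof eventually_elim
    case (elim z)
    then have z: "norm z = 1" "z \<noteq> 1" by auto
    define q where "q = norm (1 - z)"
    have q: "0 < q" "q < 1" using z elim by (auto simp: q_def)
    \<comment> \<open>Here q < 1 ensures that rounding up stays below (A + 1)/q.\<close>
    define M where "M = nat \<lceil>A / q\<rceil>"
    have M: "A / q \<le> real M" "real M \<le> (A + 1) / q"
    proof -
      show "A / q \<le> real M" unfolding M_def by linarith
      have "real M \<le> A / q + 1" using q A unfolding M_def
        by (smt (verit) divide_pos_pos of_nat_nat of_int_ceiling_le_add_one zero_less_ceiling)
      also have "\<dots> \<le> (A + 1) / q" using q by (simp add: field_simps)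
      finally show "real M \<le> (A + 1) / q" .
    qed
    have M1: "1 \<le> M" using q M A
      by (metis Suc_leI One_nat_def divide_pos_pos less_le_trans of_nat_0_less_iff)
    have "norm (\<Sum>h<M. weighted a m h * z ^ h) \<le> (\<Sum>h<M. norm (weighted a m h))"
      by (rule sum_norm_le) (simp add: norm_mult norm_power z)
    also have "\<dots> \<le> K + e / (3 * (A + 1) powr a) * real M powr a" by (rule K)
    also have "\<dots> \<le> K + e / (3 * (A + 1) powr a) * ((A + 1) / q) powr a"
      using e a M A by (intro add_left_mono mult_left_mono powr_mono2) auto
    also have "\<dots> = K + e / 3 * q powr (- a)"
      using q A by (simp add: powr_divide powr_minus_divide)
    finally have head: "norm (\<Sum>h<M. weighted a m h * z ^ h) \<le> K + e / 3 * q powr (- a)" .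
    have "norm ((\<Sum>h. weighted a m h * z ^ h) - (\<Sum>h<M. weighted a m h * z ^ h)) \<le> C * real M powr (a - 1) / q"
      using tail[OF M1 z] by (simp add: q_def)
    also have "\<dots> \<le> C * (A / q) powr (a - 1) / q"
      using C q M A a by (intro divide_right_mono mult_left_mono powr_mono2') auto
    also have "\<dots> = (C * A powr (a - 1)) * q powr (- a)"
      using q A by (simp add: powr_divide powr_minus_divide powr_diff)
    also have "\<dots> \<le> e / 3 * q powr (- a)" using A by (intro mult_right_mono) auto
    finally have "norm (\<Sum>h. weighted a m h * z ^ h) \<le> K + e / 3 * q powr (- a) + e / 3 * q powr (- a)"
      using head norm_triangle_sub[of "\<Sum>h. weighted a m h * z ^ h" "\<Sum>h<M. weighted a m h * z ^ h"] by linarith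
    then have "q powr a * norm (\<Sum>h. weighted a m h * z ^ h)
        \<le> q powr a * (K + e / 3 * q powr (- a) + e / 3 * q powr (- a))"
      by (intro mult_left_mono) auto
    also have "\<dots> = q powr a * K + 2 * (e / 3)"
      using q by (simp add: powr_minus field_simps)
    also have "\<dots> < e" using elim by (simp add: q_def)
    finally show ?case by (simp add: q_def)
  qed
qed

subsection \<open>The binomial series on the unit circle\<close>

text \<open>For every t in [0,1] the numbers p_h t^h are again decreasing, so their variation
  telescopes and the tail beyond M is at most 4 p_M/|1-z|, independently of t. Hence the convergence
  is uniform up to t = 1 and the limit function is continuous there.\<close>

lemma Abel_limit_decreasing_coeffs:
  fixes p :: "nat \<Rightarrow> real" and z :: complex
  assumes dec: "\<And>h. p (Suc h) \<le> p h" and p0: "p \<longlonglongrightarrow> 0" and z: "norm z = 1" "z \<noteq> 1"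
  shows "summable (\<lambda>h. of_real (p h) * z ^ h)"
    and "((\<lambda>t. \<Sum>h. of_real (p h) * (of_real t * z) ^ h) \<longlongrightarrow> (\<Sum>h. of_real (p h) * z ^ h)) (at_left 1)"
proof -
  define f where "f N t = (\<Sum>h<N. complex_of_real (p h) * (of_real t * z) ^ h)" for N :: nat and t :: real
  have "decseq p" using dec by (rule decseq_SucI)
  then have nn: "0 \<le> p h" for h using decseq_ge[OF _ p0] by blast
  have tail: "norm (f N t - f M t) \<le> 4 * p M / norm (1 - z)" if t: "t \<in> {0..1}" and MN: "M \<le> N" for M N t
  proof -
    define b where "b h = complex_of_real (p h * t ^ h)" for h
    have b_dec: "p (Suc h) * t ^ Suc h \<le> p h * t ^ h" for h
      using dec nn t by (intro mult_mono power_decreasing) auto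
    have pt: "0 \<le> p M * t ^ M" "p M * t ^ M \<le> p M"
      using nn[of M] t by (auto simp: mult_left_le power_le_one)
    have "f N t - f M t = (\<Sum>h=M..<N. b h * z ^ h)"
      using sum_diff_nat_ivl[of 0 M N "\<lambda>h. b h * z ^ h"] MN
      by (simp add: f_def b_def lessThan_atLeast0 power_mult_distrib mult.assoc)
    moreover have "(\<Sum>h=M..<N. norm (b (Suc h) - b h)) = (\<Sum>h=M..<N. p h * t ^ h - p (Suc h) * t ^ Suc h)"
      unfolding b_def of_real_diff[symmetric] norm_of_real using b_dec by (intro sum.cong) auto
    moreover have "\<dots> = p M * t ^ M - p N * t ^ N"
      using sum_Suc_diff'[OF MN, of "\<lambda>h. - (p h * t ^ h)"] by (simp del: power_Suc)
    moreover have "norm (b M) = p M * t ^ M"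
      unfolding b_def norm_of_real using pt by simp
    ultimately have "norm (f N t - f M t) \<le> 2 * (p M * t ^ M + (p M * t ^ M - p N * t ^ N)) / norm (1 - z)"
      using norm_power_sum_le[OF MN z, of b] by simp
    also have "\<dots> \<le> 4 * p M / norm (1 - z)"
    proof (rule divide_right_mono)
      have "2 * (x + (x - y)) \<le> 4 * P" if "0 \<le> y" "x \<le> P" for x y P :: real
        using that by simp
      moreover have "0 \<le> p N * t ^ N" using nn[of N] t by simp
      ultimately show "2 * (p M * t ^ M + (p M * t ^ M - p N * t ^ N)) \<le> 4 * p M"
        using pt by blast
    qed simp
    finally show ?thesis .
  qed
  have "uniformly_Cauchy_on {0..1} f"
  proof (rule uniformly_Cauchy_onI')
    fix e :: real assume e: "0 < e"
    have "(\<lambda>M. 4 * p M / norm (1 - z)) \<longlonglongrightarrow> 4 * 0 / norm (1 - z)"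
      using z by (intro tendsto_intros p0) auto
    from order_tendstoD(2)[OF this, of e] e
    obtain M0 where M0: "\<And>M. M \<ge> M0 \<Longrightarrow> 4 * p M / norm (1 - z) < e"
      by (auto simp: eventually_sequentially)
    have "dist (f m x) (f n x) < e" if "x \<in> {0..1}" "M0 \<le> m" "m < n" for x m n
      using tail[OF that(1), of m n] M0[OF that(2)] that(3) by (simp add: dist_norm norm_minus_commute)
    then show "\<exists>M. \<forall>x\<in>{0..1}. \<forall>m\<ge>M. \<forall>n>m. dist (f m x) (f n x) < e" by blast
  qed
  then have "uniformly_convergent_on {0..1} f" by (rule Cauchy_uniformly_convergent)
  then obtain l where l: "uniform_limit {0..1} f l sequentially"
    unfolding uniformly_convergent_on_def by blast
  have ptw: "(\<lambda>h. of_real (p h) * (of_real t * z) ^ h) sums l t" if "t \<in> {0..1}" for t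
    using tendsto_uniform_limitI[OF l that] unfolding f_def sums_def .
  from ptw[of 1] show "summable (\<lambda>h. of_real (p h) * z ^ h)" by (auto dest: sums_summable)
  have "continuous_on {0..1} l"
    by (rule uniform_limit_theorem[OF _ l]) (auto simp: f_def intro!: always_eventually continuous_intros)
  then have "(l \<longlongrightarrow> l 1) (at 1 within {0..1})" by (auto simp: continuous_on_def)
  then have "(l \<longlongrightarrow> l 1) (at_left 1)"
    by (simp add: at_within_Icc_at_left)
  moreover have "\<forall>\<^sub>F t in at_left 1. (\<Sum>h. of_real (p h) * (of_real t * z) ^ h) = l t"
    using eventually_at_left_real[OF zero_less_one] by eventually_elim (use ptw in \<open>auto simp: sums_iff\<close>)
  ultimately show "((\<lambda>t. \<Sum>h. of_real (p h) * (of_real t * z) ^ h) \<longlongrightarrow> (\<Sum>h. of_real (p h) * z ^ h)) (at_left 1)"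
    using ptw[of 1] by (simp add: sums_iff tendsto_cong)
qed

lemma binomial_series_disc:
  fixes z :: complex
  assumes "norm z < 1"
  shows "(\<lambda>h. of_real (pochhammer a h / fact h) * z ^ h) sums (1 - z) powr (- of_real a)"
proof -
  have "(\<lambda>h. ((- of_real a) gchoose h) * (- z) ^ h) sums (1 + (- z)) powr (- of_real a)"
    by (rule gen_binomial_complex) (use assms in simp)
  moreover have "((- of_real a) gchoose h) * (- z) ^ h = of_real (pochhammer a h / fact h) * z ^ h" for h :: nat
  proof -
    have "(- 1) ^ h * (- 1) ^ h = (1::complex)" by (simp flip: power_mult_distrib)
    moreover have "((- of_real a) gchoose h) * (- z) ^ h =
        ((- 1) ^ h * (- 1) ^ h) * (of_real (pochhammer a h / fact h) * z ^ h)"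
      unfolding gbinomial_pochhammer power_minus[of z] by (simp add: pochhammer_of_real)
    ultimately show ?thesis by simp
  qed
  ultimately show ?thesis by simp
qed

text \<open>The multiplier that turns the weight h^(a-1) into the coefficient of z^h in (1-z)^(-a),
  for h >= 1. It puts the binomial series into the same form as the series under study.\<close>

definition binom_ratio :: "real \<Rightarrow> nat \<Rightarrow> real" where
  "binom_ratio a h = pochhammer a h / fact h * real h powr (1 - a)"

lemma weighted_binom_ratio:
  "weighted a (\<lambda>h. of_real (binom_ratio a h)) h = (if h = 0 then 0 else of_real (pochhammer a h / fact h))"
  by (auto simp: weighted_def binom_ratio_def mult.assoc powr_add[symmetric] simp flip: of_real_mult of_real_divide)

text \<open>The reciprocal of \<open>Gamma_series'\<close>, whose factor (h-1)! = h!/h accounts for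
  the exponent 1 - a instead of -a.\<close>

lemma binom_ratio_LIMSEQ:
  assumes "0 < a"
  shows "binom_ratio a \<longlonglongrightarrow> 1 / Gamma a"
proof (rule Lim_transform_eventually)
  show "(\<lambda>h. 1 / Gamma_series' a h) \<longlonglongrightarrow> 1 / Gamma a"
    using Gamma_real_pos[OF assms] by (intro tendsto_intros Gamma_series'_LIMSEQ) simp
  show "\<forall>\<^sub>F h in sequentially. 1 / Gamma_series' a h = binom_ratio a h"
    using eventually_gt_at_top[of 0]
  proof eventually_elim
    case (elim h)
    then obtain k where "h = Suc k" by (cases h) auto
    define n where "n = real (Suc k)"
    have n: "0 < n" by (simp add: n_def)
    have "exp (a * ln n) = n powr a" using n by (simp add: powr_def)
    moreover have "fact (Suc k) = n * fact k" by (simp add: n_def)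
    moreover have "n powr (1 - a) = n / n powr a" using n by (simp add: powr_diff)
    ultimately show ?case
      using n unfolding Gamma_series'_def binom_ratio_def \<open>h = Suc k\<close> n_def[symmetric] by simp
  qed
qed

lemma binom_ratio_mono:
  assumes a: "0 < a" "a < 1" and h: "1 \<le> h"
  shows "binom_ratio a h \<le> binom_ratio a (Suc h)"
proof -
  define x where "x = real h"
  have x: "1 \<le> x" using h by (simp add: x_def)
  \<comment> \<open>Weighted arithmetic-geometric mean inequality for (x+1)/x and 1, that is,
    Bernoulli's inequality (1 + 1/x)^a <= 1 + a/x. It is equivalent to the quotient of consecutive
    ratios being at least 1.\<close>
  have "((x + 1) / x) powr a * 1 powr (1 - a) \<le> a * ((x + 1) / x) + (1 - a) * 1"
    using a x by (intro Youngs_inequality_0) auto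
  also have "\<dots> = (x + a) / x" using x by (simp add: field_simps)
  finally have "(x + 1) powr a / x powr a \<le> (x + a) / x" using x by (simp add: powr_divide)
  then have "x * (x + 1) powr a \<le> (x + a) * x powr a" using x by (simp add: field_simps)
  then have "x powr (1 - a) \<le> (x + a) / (x + 1) * (x + 1) powr (1 - a)"
  proof -
    have pos: "0 < x powr a" "0 < (x + 1) powr a" using x by auto
    then have "x / x powr a \<le> (x + a) / (x + 1) powr a"
      using \<open>x * (x + 1) powr a \<le> (x + a) * x powr a\<close> by (subst frac_le_eq) (auto simp: divide_le_0_iff)
    then show ?thesis using x by (simp add: powr_diff)
  qed
  then have "pochhammer a h / fact h * x powr (1 - a)
      \<le> pochhammer a h / fact h * ((x + a) / (x + 1) * (x + 1) powr (1 - a))"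
    using a by (intro mult_left_mono) (auto intro!: divide_nonneg_nonneg pochhammer_nonneg)
  also have "\<dots> = binom_ratio a (Suc h)"
    by (simp add: binom_ratio_def pochhammer_Suc x_def add_ac mult_ac)
  finally show ?thesis by (simp add: binom_ratio_def x_def)
qed

lemma dyadic_bv_mono_seq:
  fixes r :: "nat \<Rightarrow> real"
  assumes mono: "\<And>h. 1 \<le> h \<Longrightarrow> r h \<le> r (Suc h)" and B: "\<And>h. \<bar>r h\<bar> \<le> B"
  shows "dyadic_bv (\<lambda>h. complex_of_real (r h))"
  unfolding dyadic_bv_def
proof (intro exI[of _ "2 * B"] allI impI)
  fix N :: nat assume N: "1 \<le> N"
  have "(\<Sum>h=N..<2*N. norm (complex_of_real (r (Suc h)) - of_real (r h))) = (\<Sum>h=N..<2*N. r (Suc h) - r h)"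
    unfolding of_real_diff[symmetric] norm_of_real using mono N by (intro sum.cong) auto
  also have "\<dots> = r (2 * N) - r N" by (subst sum_Suc_diff') auto
  also have "\<dots> \<le> 2 * B" using B[of "2 * N"] B[of N] by linarith
  finally show "(\<Sum>h=N..<2*N. norm (complex_of_real (r (Suc h)) - of_real (r h))) \<le> 2 * B" .
qed

lemma dyadic_bv_add:
  assumes "dyadic_bv f" "dyadic_bv g"
  shows "dyadic_bv (\<lambda>h. f h + g h)"
proof -
  obtain K K' where K: "\<And>N. 1 \<le> N \<Longrightarrow> (\<Sum>h=N..<2*N. norm (f (Suc h) - f h)) \<le> K"
    "\<And>N. 1 \<le> N \<Longrightarrow> (\<Sum>h=N..<2*N. norm (g (Suc h) - g h)) \<le> K'"
    using assms unfolding dyadic_bv_def by blast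
  have "(\<Sum>h=N..<2*N. norm (f (Suc h) + g (Suc h) - (f h + g h))) \<le> K + K'" if "1 \<le> N" for N
  proof -
    have "(\<Sum>h=N..<2*N. norm (f (Suc h) + g (Suc h) - (f h + g h)))
        \<le> (\<Sum>h=N..<2*N. norm (f (Suc h) - f h) + norm (g (Suc h) - g h))"
      by (intro sum_mono) (simp add: add_diff_add norm_triangle_ineq)
    also have "\<dots> \<le> K + K'" unfolding sum.distrib by (intro add_mono K that)
    finally show ?thesis .
  qed
  then show ?thesis unfolding dyadic_bv_def by blast
qed

lemma dyadic_bv_mult:
  fixes f :: "nat \<Rightarrow> complex"
  assumes "dyadic_bv f"
  shows "dyadic_bv (\<lambda>h. c * f h)"
proof -
  obtain K where K: "\<And>N. 1 \<le> N \<Longrightarrow> (\<Sum>h=N..<2*N. norm (f (Suc h) - f h)) \<le> K"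
    using assms unfolding dyadic_bv_def by blast
  have "(\<Sum>h=N..<2*N. norm (c * f (Suc h) - c * f h)) \<le> norm c * K" if "1 \<le> N" for N
    unfolding right_diff_distrib[symmetric] norm_mult sum_distrib_left[symmetric]
    by (intro mult_left_mono K that) auto
  then show ?thesis unfolding dyadic_bv_def by blast
qed

lemma binom_ratio_bounded:
  assumes "0 < a"
  obtains B where "\<And>h. \<bar>binom_ratio a h\<bar> \<le> B"
  using convergent_imp_Bseq[OF convergentI[OF binom_ratio_LIMSEQ[OF assms]]] that
  unfolding Bseq_def by (auto simp: real_norm_def)

lemma dyadic_bv_binom_ratio:
  assumes "0 < a" "a < 1"
  shows "dyadic_bv (\<lambda>h. complex_of_real (binom_ratio a h))"
proof -
  obtain B where "\<And>h. \<bar>binom_ratio a h\<bar> \<le> B" using binom_ratio_bounded[OF assms(1)] by blast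
  then show ?thesis using binom_ratio_mono[OF assms] by (intro dyadic_bv_mono_seq)
qed

text \<open>The identity holds inside the disc and is carried to the circle by a radial limit. The
  coefficients decrease because (a + h)/(1 + h) <= 1, and they tend to 0 because they behave like a
  multiple of h^(a-1).\<close>

lemma binomial_series_circle:
  assumes a: "0 < a" "a < 1" and z: "norm z = 1" "z \<noteq> 1"
  shows "(\<Sum>h. weighted a (\<lambda>h. of_real (binom_ratio a h)) h * z ^ h) = (1 - z) powr (- of_real a) - 1"
proof -
  define p where "p h = pochhammer a h / fact h" for h :: nat
  have p_nn: "0 \<le> p h" for h
    using a by (auto simp: p_def intro!: divide_nonneg_nonneg pochhammer_nonneg)
  have "p (Suc h) = p h * ((a + real h) / (1 + real h))" for h
    by (simp add: p_def pochhammer_Suc)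
  moreover have "p h * ((a + real h) / (1 + real h)) \<le> p h" for h
    using a p_nn[of h] by (intro mult_left_le) auto
  ultimately have dec: "p (Suc h) \<le> p h" for h by simp
  have "(\<lambda>h. binom_ratio a h * real h powr (a - 1)) \<longlonglongrightarrow> 1 / Gamma a * 0"
    using a by (intro tendsto_intros tendsto_neg_powr filterlim_real_sequentially binom_ratio_LIMSEQ) auto
  moreover have "\<forall>\<^sub>F h in sequentially. binom_ratio a h * real h powr (a - 1) = p h"
    using eventually_gt_at_top[of 0]
    by eventually_elim (auto simp: binom_ratio_def p_def mult.assoc powr_add[symmetric])
  ultimately have p0: "p \<longlonglongrightarrow> 0" by (simp add: tendsto_cong)
  note Abel = Abel_limit_decreasing_coeffs[OF dec p0 z]
  have disc: "(\<Sum>h. of_real (p h) * (of_real t * z) ^ h) = (1 - of_real t * z) powr (- of_real a)"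
    if "0 < t" "t < 1" for t
    using binomial_series_disc[of "of_real t * z" a] that z
    unfolding p_def by (intro sums_unique[symmetric]) (simp add: norm_mult)
  \<comment> \<open>This places 1 - z in the right half-plane, off the branch cut, where the
    principal power is continuous.\<close>
  have "Re z < 1"
  proof (rule ccontr)
    assume "\<not> Re z < 1"
    then have "Re z = 1" using complex_Re_le_cmod[of z] z by simp
    moreover have "(Re z)\<^sup>2 + (Im z)\<^sup>2 = 1" using z by (simp add: cmod_power2[symmetric])
    ultimately show False using z by (simp add: complex_eq_iff)
  qed
  then have "1 - of_real 1 * z \<notin> \<real>\<^sub>\<le>\<^sub>0" by (auto simp: complex_nonpos_Reals_iff)
  then have "((\<lambda>t. (1 - of_real t * z) powr (- of_real a)) \<longlongrightarrow> (1 - of_real 1 * z) powr (- of_real a)) (at_left 1)"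
    by (intro tendsto_intros) auto
  moreover have "\<forall>\<^sub>F t in at_left 1. (\<Sum>h. of_real (p h) * (of_real t * z) ^ h) = (1 - of_real t * z) powr (- of_real a)"
    using eventually_at_left_real[OF zero_less_one] by eventually_elim (auto intro: disc)
  ultimately have "((\<lambda>t. \<Sum>h. of_real (p h) * (of_real t * z) ^ h) \<longlongrightarrow> (1 - z) powr (- of_real a)) (at_left 1)"
    by (simp add: tendsto_cong)
  then have eq: "(\<Sum>h. of_real (p h) * z ^ h) = (1 - z) powr (- of_real a)"
    using tendsto_unique[OF _ Abel(2)] by force
  \<comment> \<open>The weighted series lacks the constant term 1 of the binomial series; this is
    the origin of the -1.\<close>
  have "(\<lambda>h. weighted a (\<lambda>h. of_real (binom_ratio a h)) h * z ^ h) =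
      (\<lambda>h. of_real (p h) * z ^ h - (if h = 0 then 1 else 0))"
    unfolding weighted_binom_ratio by (auto simp: p_def)
  then have "(\<Sum>h. weighted a (\<lambda>h. of_real (binom_ratio a h)) h * z ^ h) =
      (\<Sum>h. of_real (p h) * z ^ h) - (\<Sum>h::nat. if h = 0 then 1 else 0)"
    by (simp add: suminf_diff[OF Abel(1) sums_summable[OF sums_single]])
  also have "(\<Sum>h::nat. if h = 0 then 1 else (0::complex)) = 1"
    using sums_unique[OF sums_single[of 0 "\<lambda>_. 1::complex"]] by simp
  finally show ?thesis using eq by simp
qed

section \<open>Boundary behaviour as z tends to 1\<close>

lemma one_minus_cis_over_tendsto:
  "((\<lambda>x. (1 - cis (s * x)) / of_real x) \<longlongrightarrow> - \<i> * of_real s) (at_right 0)"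
proof -
  have "((\<lambda>x. cos (s * x)) has_real_derivative 0) (at 0 within {0<..})"
    "((\<lambda>x. sin (s * x)) has_real_derivative s) (at 0 within {0<..})"
    by (auto intro!: derivative_eq_intros)
  then have "((\<lambda>x. (cos (s * x) - 1) / x) \<longlongrightarrow> 0) (at_right 0)" "((\<lambda>x. sin (s * x) / x) \<longlongrightarrow> s) (at_right 0)"
    by (simp_all add: has_field_derivative_iff)
  then have "((\<lambda>x. Complex (- ((cos (s * x) - 1) / x)) (- (sin (s * x) / x))) \<longlongrightarrow> Complex (- 0) (- s)) (at_right 0)"
    by (intro tendsto_Complex tendsto_minus)
  moreover have "Complex (- ((cos (s * x) - 1) / x)) (- (sin (s * x) / x)) = (1 - cis (s * x)) / of_real x" for x
    by (simp add: complex_eq_iff Re_divide_of_real Im_divide_of_real diff_divide_distrib)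
  moreover have "Complex (- 0) (- s) = - \<i> * of_real s" by (simp add: complex_eq_iff)
  ultimately show ?thesis by simp
qed

lemma filterlim_cis_sphere:
  assumes "s = 1 \<or> s = (-1::real)"
  shows "filterlim (\<lambda>x. cis (s * x)) (at 1 within sphere 0 1) (at_right 0)"
  unfolding filterlim_at
proof
  show "((\<lambda>x. cis (s * x)) \<longlongrightarrow> 1) (at_right 0)"
    by (auto intro!: tendsto_eq_intros)
  show "\<forall>\<^sub>F x in at_right 0. cis (s * x) \<in> sphere 0 1 \<and> cis (s * x) \<noteq> 1"
    using eventually_at_right_real[of 0 pi, OF pi_gt_zero]
  proof eventually_elim
    case (elim x)
    then have "sin x \<noteq> 0" using sin_gt_zero[of x] by auto
    then have "Im (cis (s * x)) \<noteq> 0" using assms by auto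
    then show ?case by (auto simp del: cis.simps)
  qed
qed

text \<open>The sign s selects the side from which the point 1 is approached along the circle. The
  argument of the limit comes only from the direction -i s in which 1 - cis(s x) leaves 0.\<close>

lemma weighted_series_asymptotics:
  assumes a: "0 < a" "a < 1" and B: "\<And>h. norm (m h) \<le> B" and bv: "dyadic_bv m"
    and lim: "m \<longlonglongrightarrow> c" and s: "s = 1 \<or> s = (-1::real)"
  shows "((\<lambda>x. of_real (x powr a) * (\<Sum>h. weighted a m h * cis (s * x) ^ h))
    \<longlongrightarrow> c * of_real (Gamma a) * cis (s * (pi * a / 2))) (at_right 0)"
proof -
  define r where "r h = complex_of_real (binom_ratio a h)" for h
  define k where "k = c * of_real (Gamma a)"
  \<comment> \<open>Since r_h tends to 1/Gamma(a), the multiple k = c Gamma(a) is the one for which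
    the difference n_h tends to 0.\<close>
  define n where "n h = m h + (- k) * r h" for h
  have Ga: "Gamma a \<noteq> 0" using Gamma_real_pos[OF a(1)] by simp
  have r_lim: "r \<longlonglongrightarrow> of_real (1 / Gamma a)"
    unfolding r_def by (intro tendsto_of_real binom_ratio_LIMSEQ a)
  have r_bv: "dyadic_bv r" unfolding r_def[abs_def] by (rule dyadic_bv_binom_ratio[OF a])
  obtain B' where B': "\<And>h. norm (r h) \<le> B'"
    using binom_ratio_bounded[OF a(1)] unfolding r_def norm_of_real by metis
  have n_lim: "n \<longlonglongrightarrow> c + (- k) * of_real (1 / Gamma a)"
    unfolding n_def[abs_def] by (intro tendsto_intros lim r_lim)
  then have n_lim: "n \<longlonglongrightarrow> 0" using Ga by (simp add: k_def)
  have n_bv: "dyadic_bv n" unfolding n_def[abs_def] by (intro dyadic_bv_add dyadic_bv_mult bv r_bv)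
  have n_B: "norm (n h) \<le> B + norm k * B'" for h
    unfolding n_def by (intro norm_triangle_mono B) (auto simp: norm_mult intro!: mult_left_mono B')
  have split: "(\<Sum>h. weighted a m h * z ^ h) =
      (\<Sum>h. weighted a n h * z ^ h) + k * ((1 - z) powr (- of_real a) - 1)" if z: "norm z = 1" "z \<noteq> 1" for z
  proof -
    have "summable (\<lambda>h. weighted a n h * z ^ h)" using weighted_tail[OF a(2) n_B n_bv] z by metis
    moreover have "summable (\<lambda>h. weighted a r h * z ^ h)" using weighted_tail[OF a(2) B' r_bv] z by metis
    moreover have "weighted a m h * z ^ h = weighted a n h * z ^ h + k * (weighted a r h * z ^ h)" for h
      by (simp add: weighted_def n_def algebra_simps)
    ultimately have "(\<Sum>h. weighted a m h * z ^ h) =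
        (\<Sum>h. weighted a n h * z ^ h) + k * (\<Sum>h. weighted a r h * z ^ h)"
      by (simp add: suminf_add[symmetric] suminf_mult summable_mult)
    then show ?thesis using binomial_series_circle[OF a z] by (simp add: r_def[abs_def])
  qed
  define g where "g x = (1 - cis (s * x)) / of_real x" for x
  have g_lim: "(g \<longlongrightarrow> - \<i> * of_real s) (at_right 0)"
    unfolding g_def by (rule one_minus_cis_over_tendsto)
  \<comment> \<open>The principal argument of -i s is -s pi/2, and the exponent -a reverses its
    sign.\<close>
  have ang: "(- \<i> * of_real s) powr (- of_real a) = cis (s * (pi * a / 2))"
    using s by (auto simp: powr_def cis_conv_exp mult_ac)
  have "- \<i> * of_real s \<notin> \<real>\<^sub>\<le>\<^sub>0" using s by (auto simp: complex_nonpos_Reals_iff)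
  then have lim1: "((\<lambda>x. g x powr (- of_real a)) \<longlongrightarrow> cis (s * (pi * a / 2))) (at_right 0)"
    unfolding ang[symmetric] by (intro tendsto_intros g_lim) auto
  have x0: "((\<lambda>x. x powr a) \<longlongrightarrow> 0) (at_right 0)"
    using a by (intro tendsto_eq_intros) (auto simp: eventually_at_filter)
  \<comment> \<open>The smallness estimate is normalised by |1 - cis(s x)|^a instead of x^a; the
    factor |g x|^(-a), which converges, converts one into the other.\<close>
  have "((\<lambda>x. norm (g x) powr (- a) * (norm (1 - cis (s * x)) powr a * norm (\<Sum>h. weighted a n h * cis (s * x) ^ h)))
      \<longlongrightarrow> norm (- \<i> * of_real s) powr (- a) * 0) (at_right 0)"
    using s by (intro tendsto_intros g_lim filterlim_compose[OF weighted_series_small[OF a n_B n_bv n_lim] filterlim_cis_sphere]) auto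
  moreover have "\<forall>\<^sub>F x in at_right 0. norm (g x) powr (- a) * (norm (1 - cis (s * x)) powr a * norm (\<Sum>h. weighted a n h * cis (s * x) ^ h))
      = norm (of_real (x powr a) * (\<Sum>h. weighted a n h * cis (s * x) ^ h))"
    using filterlim_cis_sphere[OF s, unfolded filterlim_at, THEN conjunct1] eventually_at_right_less[of "0::real"]
  proof eventually_elim
    case (elim x)
    define q where "q = norm (1 - cis (s * x))"
    have q: "0 < q" using elim by (simp add: q_def)
    have "norm (g x) = q / x" using elim by (simp add: g_def q_def norm_divide)
    then have "norm (g x) powr (- a) * q powr a = x powr a"
      using q elim by (simp add: powr_divide powr_minus_divide)
    then show ?case by (simp add: norm_mult q_def flip: mult.assoc)
  qed
  ultimately have "((\<lambda>x. norm (of_real (x powr a) * (\<Sum>h. weighted a n h * cis (s * x) ^ h))) \<longlongrightarrow> 0) (at_right 0)"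
    by (simp add: tendsto_cong)
  then have small: "((\<lambda>x. of_real (x powr a) * (\<Sum>h. weighted a n h * cis (s * x) ^ h)) \<longlongrightarrow> 0) (at_right 0)"
    by (rule tendsto_norm_zero_cancel)
  have "((\<lambda>x. of_real (x powr a) * (\<Sum>h. weighted a n h * cis (s * x) ^ h) + k * (g x powr (- of_real a) - of_real (x powr a)))
      \<longlongrightarrow> 0 + k * (cis (s * (pi * a / 2)) - of_real 0)) (at_right 0)"
    by (intro tendsto_intros small lim1 x0)
  moreover have "\<forall>\<^sub>F x in at_right 0. of_real (x powr a) * (\<Sum>h. weighted a n h * cis (s * x) ^ h) + k * (g x powr (- of_real a) - of_real (x powr a))
      = of_real (x powr a) * (\<Sum>h. weighted a m h * cis (s * x) ^ h)"
    using filterlim_cis_sphere[OF s, unfolded filterlim_at, THEN conjunct1] eventually_at_right_less[of "0::real"]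
  proof eventually_elim
    case (elim x)
    have "1 - cis (s * x) = of_real x * g x" using elim by (simp add: g_def)
    \<comment> \<open>The complex power of this product splits because the factor x is a positive
      real and leaves the argument unchanged.\<close>
    then have "(1 - cis (s * x)) powr (- of_real a) = of_real x powr (- of_real a) * g x powr (- of_real a)"
      using elim by (simp add: powr_times_real_left)
    moreover have "complex_of_real x powr (- of_real a) = of_real (x powr (- a))"
      using elim powr_of_real[of x "- a"] by simp
    moreover have "complex_of_real (x powr a) * of_real (x powr (- a)) = 1"
      using elim by (simp add: powr_add[symmetric] flip: of_real_mult)
    ultimately have gx: "of_real (x powr a) * (1 - cis (s * x)) powr (- of_real a) = g x powr (- of_real a)"
      by (simp add: mult.assoc[symmetric])
    have eq: "(\<Sum>h. weighted a m h * cis (s * x) ^ h) =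
        (\<Sum>h. weighted a n h * cis (s * x) ^ h) + k * ((1 - cis (s * x)) powr (- of_real a) - 1)"
      using elim by (intro split) auto
    show ?case unfolding gx[symmetric] eq by (simp add: algebra_simps)
  qed
  ultimately show ?thesis by (simp add: tendsto_cong k_def)
qed

subsection \<open>Quasi-monotone functions\<close>

text \<open>Appending the interval from a to b to any division of [0, a] yields a division of
  [0, b]; the supremum is then taken over the former.\<close>

lemma total_variation_add_le:
  assumes bv: "bounded_variation g 0 b" and ab: "0 \<le> a" "a \<le> b"
  shows "total_variation g 0 a + \<bar>g b - g a\<bar> \<le> total_variation g 0 b"
proof (cases "a = b")
  case False
  then have ab': "a < b" using ab by simp
  have "v + \<bar>g b - g a\<bar> \<in> variation_sums g 0 b" if v_in: "v \<in> variation_sums g 0 a" for v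
  proof -
    obtain D where D: "D division_of {0..a}" and v: "v = (\<Sum>K\<in>D. \<bar>g (Sup K) - g (Inf K)\<bar>)"
      using v_in unfolding variation_sums_def by blast
    have "{{a..b}} division_of {a..b}" using ab' division_of_self[of a b] by simp
    then have "D \<union> {{a..b}} division_of {0..a} \<union> {a..b}"
      by (intro division_disjoint_union D) auto
    also have "{0..a} \<union> {a..b} = {0..b}" using ab by auto
    finally have "D \<union> {{a..b}} division_of {0..b}" .
    \<comment> \<open>A division is a set, so the appended interval must be new for its increment to
      be counted. A degenerate one could already belong to D, hence the separate case a = b.\<close>
    moreover have "{a..b} \<notin> D"
    proof
      assume "{a..b} \<in> D"
      then have "{a..b} \<subseteq> {0..a}" by (rule division_ofD(2)[OF D])
      then show False using ab' by auto
    qed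
    then have "v + \<bar>g b - g a\<bar> = (\<Sum>K\<in>D \<union> {{a..b}}. \<bar>g (Sup K) - g (Inf K)\<bar>)"
      using ab division_of_finite[OF D] by (simp add: v)
    ultimately show ?thesis unfolding variation_sums_def by blast
  qed
  then have "v \<le> total_variation g 0 b - \<bar>g b - g a\<bar>" if "v \<in> variation_sums g 0 a" for v
    using cSup_upper[of "v + \<bar>g b - g a\<bar>" "variation_sums g 0 b"] that bv
    unfolding total_variation_def bounded_variation_def by (simp add: le_diff_eq)
  moreover have "variation_sums g 0 a \<noteq> {}"
  proof -
    have "{{0..a}} division_of {0..a}" using ab division_of_self[of 0 a] by simp
    then show ?thesis unfolding variation_sums_def by blast
  qed
  ultimately have "total_variation g 0 a \<le> total_variation g 0 b - \<bar>g b - g a\<bar>"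
    unfolding total_variation_def[of g 0 a] by (intro cSup_least) auto
  then show ?thesis by simp
qed simp

text \<open>On [y, 2y] the integrand is at least y^\<delta>, and the part over [0, y] is nonnegative
  as V is increasing. The comparison is made on Riemann-Stieltjes sums, with an error e.\<close>

lemma RS_integral_powr_ge:
  assumes I: "has_RS_integral (\<lambda>u. u powr \<delta>) V 0 (2 * y) i" and y: "0 < y" and \<delta>: "0 < \<delta>"
    and mono: "\<And>s t. 0 \<le> s \<Longrightarrow> s \<le> t \<Longrightarrow> V s \<le> V t"
  shows "y powr \<delta> * (V (2 * y) - V y) \<le> i"
proof (rule field_le_epsilon)
  fix e :: real assume e: "0 < e"
  from I[unfolded has_RS_integral_def, rule_format, OF e] obtain \<eta> where \<eta>: "0 < \<eta>" and RS: "\<And>p. p tagged_division_of {0..2 * y} \<Longrightarrow> (\<lambda>t. ball t \<eta>) fine p \<Longrightarrow>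
      \<bar>(\<Sum>(t, K)\<in>p. t powr \<delta> * (V (Sup K) - V (Inf K))) - i\<bar> < e"
    by blast
  \<comment> \<open>Gluing fine divisions of the two halves makes y a division point, so that no
    interval straddles it.\<close>
  obtain p1 where p1: "p1 tagged_division_of {0..y}" "(\<lambda>t. ball t \<eta>) fine p1"
    by (rule fine_division_exists_real[OF gauge_ball[OF \<eta>]])
  obtain p2 where p2: "p2 tagged_division_of {y..2 * y}" "(\<lambda>t. ball t \<eta>) fine p2"
    by (rule fine_division_exists_real[OF gauge_ball[OF \<eta>]])
  have "p1 \<union> p2 tagged_division_of {0..y} \<union> {y..2 * y}"
    by (intro tagged_division_Un p1 p2) auto
  also have "{0..y} \<union> {y..2 * y} = {0..2 * y}" using y by auto
  finally have p: "p1 \<union> p2 tagged_division_of {0..2 * y}" .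
  have piece: "V (Inf K) \<le> V (Sup K)" if "(t, K) \<in> p1 \<union> p2" for t K
  proof -
    note tK = that
    obtain c d where K: "K = {c..d}" using tagged_division_ofD(4)[OF p tK] by auto
    have "t \<in> K" "K \<subseteq> {0..2 * y}" using tagged_division_ofD(2,3)[OF p tK] by auto
    then have "0 \<le> c" "c \<le> d" using K by auto
    then show ?thesis using mono K by simp
  qed
  have "y powr \<delta> * (V (2 * y) - V y) = y powr \<delta> * (\<Sum>(t, K)\<in>p2. V (Sup K) - V (Inf K))"
    using additive_tagged_division_1[OF _ p2(1), of V] y by simp
  also have "\<dots> = (\<Sum>(t, K)\<in>p2. y powr \<delta> * (V (Sup K) - V (Inf K)))"
    by (simp add: sum_distrib_left case_prod_unfold)
  also have "\<dots> \<le> (\<Sum>(t, K)\<in>p2. t powr \<delta> * (V (Sup K) - V (Inf K)))"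
  proof (rule sum_mono, clarify)
    fix t K assume tK: "(t, K) \<in> p2"
    then have "y \<le> t" using tagged_division_ofD(2,3)[OF p2(1) tK] by auto
    then show "y powr \<delta> * (V (Sup K) - V (Inf K)) \<le> t powr \<delta> * (V (Sup K) - V (Inf K))"
      using piece[of t K] tK y \<delta> by (intro mult_right_mono powr_mono2) auto
  qed
  also have "\<dots> \<le> (\<Sum>(t, K)\<in>p1 \<union> p2. t powr \<delta> * (V (Sup K) - V (Inf K)))"
    using tagged_division_of_finite[OF p]
    by (intro sum_mono2) (auto split: prod.splits intro!: mult_nonneg_nonneg dest: piece[OF UnI1])
  also have "\<dots> \<le> i + e" using RS[OF p fine_Un[OF p1(2) p2(2)]] by linarith
  finally show "y powr \<delta> * (V (2 * y) - V y) \<le> i + e" .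
qed

text \<open>With V the variation function, y^\<delta> (V(2y) - V(y)) is at most the Stieltjes
  integral up to 2y, hence O((2y)^\<delta> L(2y)). Dividing by y^\<delta> leaves O(1), since the
  convergent L is eventually bounded; increments of V dominate the differences of L at
  integers.\<close>

lemma quasi_monotone_dyadic_bv:
  assumes qm: "quasi_monotone L" and lim: "(L \<longlongrightarrow> c) at_top"
  shows "dyadic_bv (\<lambda>h. complex_of_real (L (real h)))"
proof -
  define V where "V = total_variation L 0"
  obtain \<delta> I where \<delta>: "0 < \<delta>"
    and I: "\<And>x. 0 < x \<Longrightarrow> has_RS_integral (\<lambda>u. u powr \<delta>) V 0 x (I x)"
    and I_O: "I \<in> O[at_top](\<lambda>x. x powr \<delta> * L x)"
    and bv: "\<And>b. 0 \<le> b \<Longrightarrow> bounded_variation L 0 b"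
    using qm unfolding quasi_monotone_def V_def by auto
  have step: "V s + \<bar>L t - L s\<bar> \<le> V t" if "0 \<le> s" "s \<le> t" for s t
    unfolding V_def by (rule total_variation_add_le) (use that bv in auto)
  have mono: "V s \<le> V t" if "0 \<le> s" "s \<le> t" for s t
    using step[OF that] by linarith
  obtain C where C: "0 < C" "\<forall>\<^sub>F x in at_top. norm (I x) \<le> C * norm (x powr \<delta> * L x)"
    using landau_o.bigE[OF I_O] by blast
  have "\<forall>\<^sub>F x in at_top. \<bar>L x\<bar> < \<bar>c\<bar> + 1"
    using order_tendstoD(2)[OF tendsto_rabs[OF lim], of "\<bar>c\<bar> + 1"] by simp
  with C(2) have "\<forall>\<^sub>F x in at_top. \<bar>L x\<bar> < \<bar>c\<bar> + 1 \<and> norm (I x) \<le> C * norm (x powr \<delta> * L x)"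
    by eventually_elim simp
  then obtain x0 where x0: "\<And>x. x0 \<le> x \<Longrightarrow> \<bar>L x\<bar> < \<bar>c\<bar> + 1 \<and> norm (I x) \<le> C * norm (x powr \<delta> * L x)"
    unfolding eventually_at_top_linorder by blast
  define N0 where "N0 = Suc (nat \<lceil>x0\<rceil>)"
  have N0: "x0 \<le> real N0" unfolding N0_def by linarith
  \<comment> \<open>The estimate holds only beyond x0; the second summand covers all blocks starting
    below N0, as each of them lies in [0, 2 N0].\<close>
  define K where "K = C * 2 powr \<delta> * (\<bar>c\<bar> + 1) + (V (2 * real N0) - V 0)"
  have large: "V (2 * y) - V y \<le> C * 2 powr \<delta> * (\<bar>c\<bar> + 1)" if y: "x0 \<le> y" "0 < y" for y
  proof -
    have "y powr \<delta> * (V (2 * y) - V y) \<le> I (2 * y)"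
      using y \<delta> by (intro RS_integral_powr_ge I mono) auto
    also have "\<dots> \<le> C * ((2 * y) powr \<delta> * \<bar>L (2 * y)\<bar>)"
      using conjunct2[OF x0[of "2 * y"]] y by (simp add: abs_mult abs_le_iff)
    also have "\<dots> \<le> C * ((2 * y) powr \<delta> * (\<bar>c\<bar> + 1))"
      using x0[of "2 * y"] y C by (intro mult_left_mono) auto
    also have "\<dots> = y powr \<delta> * (C * 2 powr \<delta> * (\<bar>c\<bar> + 1))"
      using y by (simp add: powr_mult)
    finally show ?thesis using y by (subst (asm) mult_le_cancel_left_pos) auto
  qed
  have bound: "V (2 * real N) - V (real N) \<le> K" if "1 \<le> N" for N
  proof (cases "N0 \<le> N")
    case True
    then have "V (2 * real N) - V (real N) \<le> C * 2 powr \<delta> * (\<bar>c\<bar> + 1)"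
      using N0 that by (intro large) auto
    moreover have "V 0 \<le> V (2 * real N0)" by (intro mono) auto
    ultimately show ?thesis by (simp add: K_def)
  next
    case False
    then have "V (2 * real N) \<le> V (2 * real N0)" "V 0 \<le> V (real N)" by (auto intro!: mono)
    moreover have "0 \<le> C * 2 powr \<delta> * (\<bar>c\<bar> + 1)" using C by simp
    ultimately show ?thesis unfolding K_def by linarith
  qed
  have "(\<Sum>h=N..<2*N. norm (complex_of_real (L (real (Suc h))) - of_real (L (real h)))) \<le> K" if N: "1 \<le> N" for N
  proof -
    have "(\<Sum>h=N..<2*N. norm (complex_of_real (L (real (Suc h))) - of_real (L (real h))))
        \<le> (\<Sum>h=N..<2*N. V (real (Suc h)) - V (real h))"
      unfolding of_real_diff[symmetric] norm_of_real real_norm_def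
    proof (rule sum_mono)
      fix h show "\<bar>L (real (Suc h)) - L (real h)\<bar> \<le> V (real (Suc h)) - V (real h)"
        using step[of "real h" "real (Suc h)"] by simp
    qed
    also have "\<dots> = V (2 * real N) - V (real N)"
      using sum_Suc_diff'[of N "2 * N" "\<lambda>h. V (real h)"] by simp
    also have "\<dots> \<le> K" by (rule bound[OF N])
    finally show ?thesis .
  qed
  then show ?thesis unfolding dyadic_bv_def by blast
qed

subsection \<open>Spectral densities as limits of Fourier partial sums\<close>

lemma covariance_commute: "covariance M Y Z = covariance M Z Y"
  by (simp add: covariance_def mult.commute)

lemma autocovariance_diff:
  assumes "second_order_stationary M X"
  shows "covariance M (X j) (X k) = autocovariance M X (j - k)"
  using assms unfolding second_order_stationary_def autocovariance_def
  by (metis add.commute diff_add_cancel)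

lemma autocovariance_minus:
  assumes "second_order_stationary M X"
  shows "autocovariance M X (- h) = autocovariance M X h"
  using autocovariance_diff[OF assms, of 0 h] autocovariance_diff[OF assms, of h 0] covariance_commute[of M "X 0" "X h"]
  by simp

text \<open>The double sum is the variance of the linear combination of X_0, ..., X_(N-1) with
  weights w. Integrability of the products of centred variables permits exchanging sum and
  expectation.\<close>

lemma autocovariance_quadratic_form_nonneg:
  fixes w :: "nat \<Rightarrow> real"
  assumes X: "second_order_stationary M X"
  shows "0 \<le> (\<Sum>j<N. \<Sum>k<N. w j * w k * autocovariance M X (int j - int k))"
proof -
  interpret prob_space M using X by (simp add: second_order_stationary_def)
  define Y where "Y n \<omega> = X n \<omega> - (LINT \<omega>'|M. X n \<omega>')" for n \<omega>
  have meas: "X n \<in> borel_measurable M" and sq: "integrable M (\<lambda>\<omega>. (X n \<omega>)\<^sup>2)" for n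
    using X by (auto simp: second_order_stationary_def)
  have int: "integrable M (X n)" for n
    by (rule square_integrable_imp_integrable[OF meas sq])
  have Y_meas: "Y n \<in> borel_measurable M" for n
    unfolding Y_def using meas by measurable
  have Y_sq: "integrable M (\<lambda>\<omega>. (Y n \<omega>)\<^sup>2)" for n
    unfolding Y_def power2_diff using sq int by (intro Bochner_Integration.integrable_add Bochner_Integration.integrable_diff) auto
  have Y_prod: "integrable M (\<lambda>\<omega>. Y j \<omega> * Y k \<omega>)" for j k
  proof (rule Bochner_Integration.integrable_bound)
    show "integrable M (\<lambda>\<omega>. (Y j \<omega>)\<^sup>2 + (Y k \<omega>)\<^sup>2)" using Y_sq by auto
    show "(\<lambda>\<omega>. Y j \<omega> * Y k \<omega>) \<in> borel_measurable M" using Y_meas by measurable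
    have "norm (x * y) \<le> norm (x\<^sup>2 + y\<^sup>2)" for x y :: real
    proof -
      have "2 * (\<bar>x\<bar> * \<bar>y\<bar>) \<le> x\<^sup>2 + y\<^sup>2" using sum_squares_bound[of "\<bar>x\<bar>" "\<bar>y\<bar>"] by (simp add: mult_ac)
      moreover have "0 \<le> \<bar>x\<bar> * \<bar>y\<bar>" by simp
      ultimately have "\<bar>x\<bar> * \<bar>y\<bar> \<le> x\<^sup>2 + y\<^sup>2" by linarith
      then show ?thesis by (simp add: abs_mult)
    qed
    then show "AE \<omega> in M. norm (Y j \<omega> * Y k \<omega>) \<le> norm ((Y j \<omega>)\<^sup>2 + (Y k \<omega>)\<^sup>2)"
      by (rule AE_I2)
  qed
  have "(\<Sum>j<N. \<Sum>k<N. w j * w k * autocovariance M X (int j - int k))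
      = (\<Sum>j<N. \<Sum>k<N. w j * w k * (LINT \<omega>|M. Y (int j) \<omega> * Y (int k) \<omega>))"
    unfolding autocovariance_diff[OF X, symmetric] covariance_def Y_def ..
  also have "\<dots> = (LINT \<omega>|M. (\<Sum>j<N. \<Sum>k<N. w j * w k * (Y (int j) \<omega> * Y (int k) \<omega>)))"
    using Y_prod by (simp add: Bochner_Integration.integral_sum)
  also have "\<dots> = (LINT \<omega>|M. (\<Sum>j<N. w j * Y (int j) \<omega>)\<^sup>2)"
    by (simp add: power2_eq_square sum_product mult_ac)
  also have "\<dots> \<ge> 0" by simp
  finally show ?thesis .
qed

lemma symmetric_fourier_sum:
  assumes even: "\<And>h. \<gamma> (- h) = \<gamma> h"
  shows "(\<Sum>h\<in>{- int N..int N}. cis (- (of_int h * \<nu>)) * complex_of_real (\<gamma> h)) =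
    of_real (\<gamma> 0 + 2 * (\<Sum>h<N. \<gamma> (int (Suc h)) * cos (real (Suc h) * \<nu>)))"
proof (induction N)
  case (Suc N)
  have "{- int (Suc N)..int (Suc N)} = insert (int (Suc N)) (insert (- int (Suc N)) {- int N..int N})" by auto
  then have "(\<Sum>h\<in>{- int (Suc N)..int (Suc N)}. cis (- (of_int h * \<nu>)) * complex_of_real (\<gamma> h)) =
      cis (- (real (Suc N) * \<nu>)) * of_real (\<gamma> (int (Suc N))) + (cis (real (Suc N) * \<nu>) * of_real (\<gamma> (int (Suc N)))
      + (\<Sum>h\<in>{- int N..int N}. cis (- (of_int h * \<nu>)) * complex_of_real (\<gamma> h)))"
    using even[of "int (Suc N)"] by (simp del: of_nat_Suc cis.simps)
  also have "\<dots> = of_real (2 * (\<gamma> (int (Suc N)) * cos (real (Suc N) * \<nu>))) +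
      (\<Sum>h\<in>{- int N..int N}. cis (- (of_int h * \<nu>)) * complex_of_real (\<gamma> h))"
    by (simp add: complex_eq_iff del: of_nat_Suc)
  finally show ?case unfolding Suc.IH by (simp add: algebra_simps del: of_nat_Suc)
qed simp

text \<open>Passing from N to N + 1 adds one row and one column that agree by symmetry; with the
  diagonal entry they form exactly the symmetric partial sum of order N. Thus the quadratic form is
  N times the Cesaro mean.\<close>

lemma Fejer_sum:
  assumes even: "\<And>h. \<gamma> (- h) = \<gamma> h"
  shows "(\<Sum>j<N. \<Sum>k<N. \<gamma> (int j - int k) * cos ((real j - real k) * \<nu>)) =
    (\<Sum>n<N. \<gamma> 0 + 2 * (\<Sum>h<n. \<gamma> (int (Suc h)) * cos (real (Suc h) * \<nu>)))"
proof (induction N)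
  case (Suc N)
  define g where "g j k = \<gamma> (int j - int k) * cos ((real j - real k) * \<nu>)" for j k
  have sym: "g j k = g k j" for j k
    using even[of "int j - int k"] cos_minus[of "(real j - real k) * \<nu>"] by (simp add: g_def algebra_simps)
  have "(\<Sum>k<N. g N k) = (\<Sum>h<N. \<gamma> (int (Suc h)) * cos (real (Suc h) * \<nu>))"
    unfolding sum.nat_diff_reindex[of "\<lambda>h. \<gamma> (int (Suc h)) * cos (real (Suc h) * \<nu>)", symmetric]
    by (intro sum.cong) (auto simp: g_def Suc_diff_Suc of_nat_diff simp del: of_nat_Suc)
  moreover have "(\<Sum>j<Suc N. \<Sum>k<Suc N. g j k) = (\<Sum>j<N. \<Sum>k<N. g j k) + 2 * (\<Sum>k<N. g N k) + g N N"
  proof -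
    have "(\<Sum>j<N. g j N) = (\<Sum>k<N. g N k)" by (intro sum.cong refl sym)
    then show ?thesis by (simp add: sum.distrib)
  qed
  ultimately show ?case using Suc.IH by (simp add: g_def del: of_nat_Suc)
qed simp

text \<open>With a negative limit s the terms would eventually lie below s/2, driving their sums to
  minus infinity.\<close>

lemma limit_nonneg_if_Cesaro_nonneg:
  fixes T :: "nat \<Rightarrow> real"
  assumes lim: "T \<longlonglongrightarrow> s" and nn: "\<And>N. 0 \<le> (\<Sum>n<N. T n)"
  shows "0 \<le> s"
proof (rule ccontr)
  assume "\<not> 0 \<le> s"
  then have s: "s < 0" by simp
  then have "\<forall>\<^sub>F n in sequentially. T n < s / 2" by (intro order_tendstoD(2)[OF lim]) simp
  then obtain H where H: "\<And>n. H \<le> n \<Longrightarrow> T n < s / 2" by (auto simp: eventually_sequentially)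
  have bd: "(\<Sum>n<H + k. T n) \<le> (\<Sum>n<H. T n) + real k * (s / 2)" for k
  proof (induction k)
    case (Suc k)
    have "real (Suc k) * (s / 2) = real k * (s / 2) + s / 2" by (simp add: distrib_right add_divide_distrib)
    moreover have "(\<Sum>n<H + Suc k. T n) = (\<Sum>n<H + k. T n) + T (H + k)" by simp
    moreover have "T (H + k) < s / 2" by (rule H) simp
    ultimately show ?case using Suc.IH by linarith
  qed simp
  obtain k where "(\<Sum>n<H. T n) < real k * (- s / 2)"
    using reals_Archimedean3[of "- s / 2"] s by auto
  then show False using bd[of k] nn[of "H + k"] by simp
qed

section \<open>Fourier coefficients of the limit\<close>

lemma integral_cis_of_int:
  "(LINT \<nu>:{-pi..pi}|lborel. cis (of_int n * \<nu>)) = (if n = 0 then 2 * of_real pi else 0)"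
proof (cases "n = 0")
  case True
  have "(LINT \<nu>:{-pi..pi}|lborel. (1::complex)) = 2 * of_real pi"
    by (simp add: set_lebesgue_integral_def scaleR_conv_of_real)
  with True show ?thesis by simp
next
  case False
  have "integral\<^sup>L lborel (\<lambda>x. indicator {-pi..pi} x *\<^sub>R cis (of_int n * x)) =
      cis (of_int n * pi) / (\<i> * of_int n) - cis (of_int n * (- pi)) / (\<i> * of_int n)"
  proof (rule integral_FTC_atLeastAtMost)
    fix x
    have "((\<lambda>z. exp (\<i> * of_int n * z) / (\<i> * of_int n)) has_field_derivative exp (\<i> * of_int n * of_real x)) (at (of_real x))"
      using False by (auto intro!: derivative_eq_intros)
    then have "((\<lambda>x. exp (\<i> * of_int n * of_real x) / (\<i> * of_int n)) has_vector_derivative exp (\<i> * of_int n * of_real x)) (at x)"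
      by (rule has_vector_derivative_real_field)
    then show "((\<lambda>x. cis (of_int n * x) / (\<i> * of_int n)) has_vector_derivative cis (of_int n * x)) (at x within {-pi..pi})"
      by (simp add: cis_conv_exp mult.assoc has_vector_derivative_at_within)
  qed (auto intro!: continuous_intros)
  also have "cis (of_int n * pi) = cis (of_int n * (- pi))"
    by (simp add: complex_eq_iff sin_int_times_real mult.commute)
  finally show ?thesis using False by (simp add: set_lebesgue_integral_def)
qed

lemma integral_fourier_partial_sum:
  assumes N: "\<bar>h\<bar> \<le> int N"
  shows "(LINT \<nu>:{-pi..pi}|lborel. cis (of_int h * \<nu>) *
    (\<Sum>k\<in>{- int N..int N}. cis (- (of_int k * \<nu>)) * complex_of_real (\<gamma> k))) = 2 * of_real pi * of_real (\<gamma> h)"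
proof -
  have "cis (of_int h * \<nu>) * (\<Sum>k\<in>{- int N..int N}. cis (- (of_int k * \<nu>)) * complex_of_real (\<gamma> k))
      = (\<Sum>k\<in>{- int N..int N}. of_real (\<gamma> k) * cis (of_int (h - k) * \<nu>))" for \<nu>
    unfolding sum_distrib_left by (intro sum.cong refl) (simp add: cis_mult mult_ac algebra_simps flip: mult.assoc)
  then have "(LINT \<nu>:{-pi..pi}|lborel. cis (of_int h * \<nu>) *
      (\<Sum>k\<in>{- int N..int N}. cis (- (of_int k * \<nu>)) * complex_of_real (\<gamma> k)))
      = (LINT \<nu>:{-pi..pi}|lborel. (\<Sum>k\<in>{- int N..int N}. of_real (\<gamma> k) * cis (of_int (h - k) * \<nu>)))"
    by simp
  also have "\<dots> = (\<Sum>k\<in>{- int N..int N}. (LINT \<nu>:{-pi..pi}|lborel. of_real (\<gamma> k) * cis (of_int (h - k) * \<nu>)))"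
    unfolding set_lebesgue_integral_def scaleR_sum_right
    by (intro Bochner_Integration.integral_sum borel_integrable_atLeastAtMost'[unfolded set_integrable_def] continuous_intros)
  also have "\<dots> = (\<Sum>k\<in>{- int N..int N}. of_real (\<gamma> k) * (if h - k = 0 then 2 * of_real pi else 0))"
    unfolding set_integral_mult_right integral_cis_of_int ..
  also have "\<dots> = (\<Sum>k\<in>{- int N..int N}. if h = k then 2 * of_real pi * of_real (\<gamma> h) else 0)"
    by (intro sum.cong) auto
  also have "\<dots> = 2 * of_real pi * of_real (\<gamma> h)" using N by (subst sum.delta') auto
  finally show ?thesis .
qed

text \<open>By orthogonality the coefficient of index h of the N-th partial sum equals \<gamma>(h)
  exactly as soon as N >= |h|. The exceptional set A, which contains the singular points, is finite
  and hence null.\<close>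

lemma spectral_density_dominated:
  assumes even: "\<And>h. \<gamma> (- h) = \<gamma> h"
    and f: "f \<in> borel_measurable borel" "\<And>\<nu>. \<nu> \<in> {-pi..pi} \<Longrightarrow> 0 \<le> f \<nu>"
    and A: "finite A" "\<And>\<nu>. \<nu> \<in> {-pi..pi} - A \<Longrightarrow> spectral_series_at \<gamma> \<nu> (f \<nu>)"
    and g: "integrable lborel g"
      "\<And>\<nu> N. \<nu> \<in> {-pi..pi} - A \<Longrightarrow>
        norm (\<Sum>k\<in>{- int N..int N}. cis (- (of_int k * \<nu>)) * complex_of_real (\<gamma> k)) \<le> g \<nu>"
  shows "spectral_density \<gamma> f"
proof -
  define D where "D N \<nu> = 1 / (2 * complex_of_real pi) *
    (\<Sum>k\<in>{- int N..int N}. cis (- (of_int k * \<nu>)) * complex_of_real (\<gamma> k))" for N \<nu>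
  have D_lim: "(\<lambda>N. D N \<nu>) \<longlonglongrightarrow> of_real (f \<nu>)" if "\<nu> \<in> {-pi..pi} - A" for \<nu>
    using A(2)[OF that] by (simp add: spectral_series_at_def D_def)
  have D_meas: "D N \<in> borel_measurable borel" for N
    unfolding D_def by (intro borel_measurable_continuous_onI continuous_intros)
  have D_bd: "norm (D N \<nu>) \<le> g \<nu>" if "\<nu> \<in> {-pi..pi} - A" for N \<nu>
  proof -
    have "norm (D N \<nu>) = 1 / (2 * pi) * norm (\<Sum>k\<in>{- int N..int N}. cis (- (of_int k * \<nu>)) * complex_of_real (\<gamma> k))"
      by (simp add: D_def norm_mult norm_divide)
    also have "\<dots> \<le> 1 * norm (\<Sum>k\<in>{- int N..int N}. cis (- (of_int k * \<nu>)) * complex_of_real (\<gamma> k))"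
      using pi_gt3 by (intro mult_right_mono) auto
    also have "\<dots> \<le> g \<nu>" using g(2)[OF that, of N] by simp
    finally show ?thesis .
  qed
  have AE: "AE \<nu> in lborel. \<nu> \<notin> A"
    by (intro AE_not_in countable_imp_null_set_lborel countable_finite A)
  have conv: "(\<lambda>N. LINT \<nu>:{-pi..pi}|lborel. cis (of_int h * \<nu>) * D N \<nu>)
      \<longlonglongrightarrow> (LINT \<nu>:{-pi..pi}|lborel. cis (of_int h * \<nu>) * complex_of_real (f \<nu>))"
    and int: "set_integrable lborel {-pi..pi} (\<lambda>\<nu>. cis (of_int h * \<nu>) * complex_of_real (f \<nu>))" for h
  proof -
    have cis_meas: "(\<lambda>\<nu>. cis (of_int h * \<nu>)) \<in> borel_measurable borel"
      by (intro borel_measurable_continuous_onI continuous_intros)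
    have m1: "(\<lambda>\<nu>. indicator {-pi..pi} \<nu> *\<^sub>R (cis (of_int h * \<nu>) * complex_of_real (f \<nu>))) \<in> borel_measurable lborel"
      using f(1) cis_meas by simp
    have m2: "(\<lambda>\<nu>. indicator {-pi..pi} \<nu> *\<^sub>R (cis (of_int h * \<nu>) * D N \<nu>)) \<in> borel_measurable lborel" for N
      using D_meas cis_meas by simp
    have g_int: "integrable lborel (\<lambda>\<nu>. indicator {-pi..pi} \<nu> * g \<nu>)"
      using integrable_mult_indicator[OF _ g(1), of "{-pi..pi}"] by simp
    have ptw: "AE \<nu> in lborel. (\<lambda>N. indicator {-pi..pi} \<nu> *\<^sub>R (cis (of_int h * \<nu>) * D N \<nu>))
        \<longlonglongrightarrow> indicator {-pi..pi} \<nu> *\<^sub>R (cis (of_int h * \<nu>) * complex_of_real (f \<nu>))"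
      using AE
    proof eventually_elim
      case (elim \<nu>)
      then show ?case
        by (cases "\<nu> \<in> {-pi..pi}") (auto intro!: tendsto_intros D_lim)
    qed
    have bd: "AE \<nu> in lborel. norm (indicator {-pi..pi} \<nu> *\<^sub>R (cis (of_int h * \<nu>) * D N \<nu>)) \<le> indicator {-pi..pi} \<nu> * g \<nu>" for N
      using AE
    proof eventually_elim
      case (elim \<nu>)
      then show ?case
        using D_bd[of \<nu> N] by (cases "\<nu> \<in> {-pi..pi}") (auto simp: norm_mult)
    qed
    show "(\<lambda>N. LINT \<nu>:{-pi..pi}|lborel. cis (of_int h * \<nu>) * D N \<nu>)
      \<longlonglongrightarrow> (LINT \<nu>:{-pi..pi}|lborel. cis (of_int h * \<nu>) * complex_of_real (f \<nu>))"
      unfolding set_lebesgue_integral_def by (rule integral_dominated_convergence[OF m1 m2 g_int ptw bd])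
    show "set_integrable lborel {-pi..pi} (\<lambda>\<nu>. cis (of_int h * \<nu>) * complex_of_real (f \<nu>))"
      unfolding set_integrable_def by (rule integrable_dominated_convergence[OF m1 m2 g_int ptw bd])
  qed
  \<comment> \<open>This is the complex integrability statement at h = 0, where the factor cis is
    1.\<close>
  have "set_integrable lborel {-pi..pi} f"
  proof -
    have "(\<lambda>\<nu>. indicator {-pi..pi} \<nu> *\<^sub>R (cis (of_int 0 * \<nu>) * complex_of_real (f \<nu>))) =
        (\<lambda>\<nu>. complex_of_real (indicator {-pi..pi} \<nu> *\<^sub>R f \<nu>))"
      by (rule ext) (simp add: scaleR_conv_of_real)
    with int[of 0] show ?thesis unfolding set_integrable_def by (metis complex_of_real_integrable_eq)
  qed
  moreover have "complex_of_real (\<gamma> h) = (LINT \<nu>:{-pi..pi}|lborel. cis (of_int h * \<nu>) * complex_of_real (f \<nu>))" for h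
  proof (rule LIMSEQ_unique[OF _ conv])
    have "(LINT \<nu>:{-pi..pi}|lborel. cis (of_int h * \<nu>) * D N \<nu>) = of_real (\<gamma> h)" if "nat \<bar>h\<bar> \<le> N" for N
    proof -
      have "(LINT \<nu>:{-pi..pi}|lborel. cis (of_int h * \<nu>) * D N \<nu>) = 1 / (2 * complex_of_real pi) *
        (LINT \<nu>:{-pi..pi}|lborel. cis (of_int h * \<nu>) *
          (\<Sum>k\<in>{- int N..int N}. cis (- (of_int k * \<nu>)) * complex_of_real (\<gamma> k)))"
        unfolding D_def set_integral_mult_right[symmetric]
        by (rule arg_cong[where f = "set_lebesgue_integral lborel {-pi..pi}"]) (rule ext, rule mult.left_commute)
      also have "\<dots> = of_real (\<gamma> h)"
        using that by (subst integral_fourier_partial_sum) auto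
      finally show ?thesis .
    qed
    then show "(\<lambda>N. LINT \<nu>:{-pi..pi}|lborel. cis (of_int h * \<nu>) * D N \<nu>) \<longlonglongrightarrow> of_real (\<gamma> h)"
      by (intro tendsto_eventually) (auto simp: eventually_sequentially)
  qed
  ultimately show ?thesis using f(2) by (simp add: spectral_density_def)
qed

subsection \<open>Modulated coefficients\<close>

lemma norm_one_minus_cis: "norm (1 - cis x) = 2 * \<bar>sin (x / 2)\<bar>"
proof -
  have "(norm (1 - cis x))\<^sup>2 = (1 - cos x)\<^sup>2 + (sin x)\<^sup>2"
    by (simp add: cmod_power2)
  also have "\<dots> = 2 - 2 * cos x"
    using sin_cos_squared_add[of x] by (simp add: power2_eq_square algebra_simps)
  also have "\<dots> = (2 * \<bar>sin (x / 2)\<bar>)\<^sup>2"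
    using cos_double_sin[of "x / 2"] by (simp add: power_mult_distrib)
  finally show ?thesis by (rule power2_eq_imp_eq) auto
qed

text \<open>The quotient of |1 - cis x| by |x| is |sinc(x/2)|, continuous and without zeros for |x|
  <= b < 2 pi, so it attains a positive minimum by compactness. The later use has b =
  \<open>pi + \<nu>\<^sub>0\<close>, the largest value of the two shifted arguments.\<close>

lemma norm_one_minus_cis_ge:
  assumes "0 < b" "b < 2 * pi"
  obtains c where "0 < c" "\<And>x. \<bar>x\<bar> \<le> b \<Longrightarrow> c * \<bar>x\<bar> \<le> norm (1 - cis x)"
proof -
  have "continuous_on {-b..b} (\<lambda>x. \<bar>sinc (x / 2)\<bar>)"
    by (intro continuous_intros) auto
  then obtain x0 where x0: "x0 \<in> {-b..b}" "\<And>x. x \<in> {-b..b} \<Longrightarrow> \<bar>sinc (x0 / 2)\<bar> \<le> \<bar>sinc (x / 2)\<bar>"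
    using continuous_attains_inf[of "{-b..b}" "\<lambda>x. \<bar>sinc (x / 2)\<bar>"] assms by auto
  have "sin (x0 / 2) \<noteq> 0" if "x0 \<noteq> 0"
    using sin_gt_zero[of "x0 / 2"] sin_gt_zero[of "- x0 / 2"] x0(1) assms that by (cases "0 < x0") auto
  then have "0 < \<bar>sinc (x0 / 2)\<bar>" by auto
  moreover have "\<bar>sinc (x0 / 2)\<bar> * \<bar>x\<bar> \<le> norm (1 - cis x)" if "\<bar>x\<bar> \<le> b" for x
  proof -
    have "\<bar>sinc (x0 / 2)\<bar> * \<bar>x\<bar> \<le> \<bar>sinc (x / 2)\<bar> * \<bar>x\<bar>"
      using that by (intro mult_right_mono x0) auto
    also have "\<dots> = norm (1 - cis x)" by (simp add: norm_one_minus_cis abs_mult)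
    finally show ?thesis .
  qed
  ultimately show ?thesis by (rule that)
qed

text \<open>The one-sided power on [0, b] is translated, reflected and added. At x = t both sides
  are 0, since \<open>0 powr (- a)\<close> is 0, so the identity holds everywhere.\<close>

lemma integrable_abs_powr_interval:
  fixes a b t :: real
  assumes "a < 1" "0 \<le> b"
  shows "integrable lborel (\<lambda>x. indicator {-b..b} (x - t) * \<bar>x - t\<bar> powr (- a))"
proof -
  define k where "k x = indicator {0..b} x * x powr (- a)" for x :: real
  have "(\<lambda>x. x powr (- a)) absolutely_integrable_on {0..b}"
    using assms by (intro nonnegative_absolutely_integrable_1 integrable_on_powr_from_0) auto
  then have "integrable (completion lborel) k"
    by (simp add: set_integrable_def k_def[abs_def])
  then have "integrable lborel k"
    by (subst (asm) integrable_completion) (auto simp: k_def[abs_def])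
  then have "integrable lborel (\<lambda>x. k (- t + 1 * x) + k (t + (- 1) * x))"
    by (intro Bochner_Integration.integrable_add lborel_integrable_real_affine) auto
  moreover have "k (- t + 1 * x) + k (t + (- 1) * x) = indicator {-b..b} (x - t) * \<bar>x - t\<bar> powr (- a)" for x
    by (cases "x - t" "0::real" rule: linorder_cases) (auto simp: k_def indicator_def)
  ultimately show ?thesis by simp
qed

text \<open>Twice the cosine is the sum of two conjugate exponentials, so one modulated coefficient
  feeds two power series; this is how the two singular points arise.\<close>

lemma double_Re_cis_cos:
  "2 * (Re (w * cis (- (real h * \<nu>\<^sub>0))) * cos (real h * \<nu>)) =
    Re (w * cis (\<nu> - \<nu>\<^sub>0) ^ h + w * cis (- (\<nu> + \<nu>\<^sub>0)) ^ h)"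
proof -
  define x y where "x = real h * \<nu>\<^sub>0" and "y = real h * \<nu>"
  have "real h * (\<nu> - \<nu>\<^sub>0) = y - x" "real h * (- (\<nu> + \<nu>\<^sub>0)) = - (y + x)"
    by (simp_all add: x_def y_def algebra_simps)
  then have "cis (\<nu> - \<nu>\<^sub>0) ^ h = cis (y - x)" "cis (- (\<nu> + \<nu>\<^sub>0)) ^ h = cis (- (y + x))"
    unfolding Complex.DeMoivre by (simp_all only:)
  then show ?thesis
    unfolding x_def[symmetric] y_def[symmetric]
    by (simp only:) (simp add: cos_diff sin_diff cos_add sin_add algebra_simps)
qed

lemma modulated_fourier_sum:
  assumes even: "\<And>h. \<gamma> (- h) = \<gamma> h"
    and \<gamma>: "\<And>h. 1 \<le> h \<Longrightarrow> \<gamma> (int h) = Re (weighted a m h * cis (- (real h * \<nu>\<^sub>0)))"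
  shows "\<gamma> 0 + 2 * (\<Sum>h<N. \<gamma> (int (Suc h)) * cos (real (Suc h) * \<nu>)) =
    \<gamma> 0 + Re (\<Sum>h<Suc N. weighted a m h * cis (\<nu> - \<nu>\<^sub>0) ^ h)
      + Re (\<Sum>h<Suc N. weighted a m h * cis (- (\<nu> + \<nu>\<^sub>0)) ^ h)"
proof -
  have "2 * (\<Sum>h<N. \<gamma> (int (Suc h)) * cos (real (Suc h) * \<nu>)) =
      (\<Sum>h<N. Re (weighted a m (Suc h) * cis (\<nu> - \<nu>\<^sub>0) ^ Suc h + weighted a m (Suc h) * cis (- (\<nu> + \<nu>\<^sub>0)) ^ Suc h))"
    unfolding sum_distrib_left double_Re_cis_cos[symmetric] by (intro sum.cong refl) (simp add: \<gamma> del: of_nat_Suc)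
  \<comment> \<open>The range grows by index 0 at no cost, because its weighted coefficient
    vanishes.\<close>
  also have "\<dots> = Re (\<Sum>h<Suc N. weighted a m h * cis (\<nu> - \<nu>\<^sub>0) ^ h + weighted a m h * cis (- (\<nu> + \<nu>\<^sub>0)) ^ h)"
    unfolding sum.lessThan_Suc_shift by (simp add: weighted_def Re_sum)
  finally show ?thesis by (simp only: sum.distrib plus_complex.sel add.assoc)
qed

text \<open>The sum of the spectral series written with its two power series: the first can be
  singular at \<open>\<nu>\<^sub>0\<close>, the second at \<open>- \<nu>\<^sub>0\<close>.\<close>

definition modulated_density :: "real \<Rightarrow> real \<Rightarrow> (nat \<Rightarrow> complex) \<Rightarrow> real \<Rightarrow> real \<Rightarrow> real" where
  "modulated_density \<gamma>\<^sub>0 a m \<nu>\<^sub>0 \<nu> =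
    (\<gamma>\<^sub>0 + Re (\<Sum>h. weighted a m h * cis (\<nu> - \<nu>\<^sub>0) ^ h)
      + Re (\<Sum>h. weighted a m h * cis (- (\<nu> + \<nu>\<^sub>0)) ^ h)) / (2 * pi)"

lemma weighted_series_bound:
  assumes a: "0 < a" "a < 1" and B: "\<And>h. norm (m h) \<le> B" and bv: "dyadic_bv m"
    and b: "0 < b" "b < 2 * pi"
  obtains C where "0 \<le> C"
    "\<And>x. x \<noteq> 0 \<Longrightarrow> \<bar>x\<bar> \<le> b \<Longrightarrow> summable (\<lambda>h. weighted a m h * cis x ^ h)"
    "\<And>N x. x \<noteq> 0 \<Longrightarrow> \<bar>x\<bar> \<le> b \<Longrightarrow> norm (\<Sum>h<N. weighted a m h * cis x ^ h) \<le> C * \<bar>x\<bar> powr (- a)"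
    "\<And>x. x \<noteq> 0 \<Longrightarrow> \<bar>x\<bar> \<le> b \<Longrightarrow> norm (\<Sum>h. weighted a m h * cis x ^ h) \<le> C * \<bar>x\<bar> powr (- a)"
proof -
  obtain C where C: "0 \<le> C" "\<And>N z. norm z = 1 \<Longrightarrow> z \<noteq> 1 \<Longrightarrow>
      norm (\<Sum>h<N. weighted a m h * z ^ h) \<le> C * norm (1 - z) powr (- a)"
    using weighted_partial_sum_bound[OF a B bv] by metis
  have summ: "summable (\<lambda>h. weighted a m h * z ^ h)" if "norm z = 1" "z \<noteq> 1" for z
    using weighted_tail[OF a(2) B bv] that by metis
  obtain k where k: "0 < k" "\<And>x. \<bar>x\<bar> \<le> b \<Longrightarrow> k * \<bar>x\<bar> \<le> norm (1 - cis x)"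
    using norm_one_minus_cis_ge[OF b] by metis
  have ne: "cis x \<noteq> 1" if x: "x \<noteq> 0" "\<bar>x\<bar> \<le> b" for x
  proof
    assume "cis x = 1"
    moreover have "0 < k * \<bar>x\<bar>" using k x by simp
    ultimately show False using k(2)[OF x(2)] by simp
  qed
  have bd: "norm (\<Sum>h<N. weighted a m h * cis x ^ h) \<le> C * k powr (- a) * \<bar>x\<bar> powr (- a)"
    if x: "x \<noteq> 0" "\<bar>x\<bar> \<le> b" for N x
  proof -
    have "norm (\<Sum>h<N. weighted a m h * cis x ^ h) \<le> C * norm (1 - cis x) powr (- a)"
      by (intro C ne x) simp
    also have "\<dots> \<le> C * (k * \<bar>x\<bar>) powr (- a)"
      using C k x a by (intro mult_left_mono powr_mono2') auto
    also have "\<dots> = C * k powr (- a) * \<bar>x\<bar> powr (- a)"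
      using k by (simp add: powr_mult)
    finally show ?thesis .
  qed
  have "norm (\<Sum>h. weighted a m h * cis x ^ h) \<le> C * k powr (- a) * \<bar>x\<bar> powr (- a)"
    if x: "x \<noteq> 0" "\<bar>x\<bar> \<le> b" for x
  proof (rule tendsto_upperbound)
    show "(\<lambda>N. norm (\<Sum>h<N. weighted a m h * cis x ^ h)) \<longlonglongrightarrow> norm (\<Sum>h. weighted a m h * cis x ^ h)"
      by (intro tendsto_norm summable_LIMSEQ summ ne x) simp
  qed (use bd[OF x] in auto)
  with bd ne summ C show ?thesis by (intro that[of "C * k powr (- a)"]) auto
qed

text \<open>Only the first series contributes. The second stays bounded near
  \<open>\<nu>\<^sub>0\<close>, so it disappears, like the variance term, after multiplication by
  x^a.\<close>

lemma modulated_density_asymptotics: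
  assumes a: "0 < a" "a < 1" and B: "\<And>h. norm (m h) \<le> B" and bv: "dyadic_bv m"
    and lim: "m \<longlonglongrightarrow> c" and s: "s = 1 \<or> s = (-1::real)" and \<nu>\<^sub>0: "0 < \<nu>\<^sub>0" "\<nu>\<^sub>0 < pi"
  shows "((\<lambda>x. x powr a * modulated_density g a m \<nu>\<^sub>0 (\<nu>\<^sub>0 + s * x))
    \<longlongrightarrow> Gamma a * Re (c * cis (s * (pi * a / 2))) / (2 * pi)) (at_right 0)"
proof -
  define F where "F x = (\<Sum>h. weighted a m h * cis x ^ h)" for x
  define b where "b = pi + \<nu>\<^sub>0"
  obtain C where C: "0 \<le> C" "\<And>x. x \<noteq> 0 \<Longrightarrow> \<bar>x\<bar> \<le> b \<Longrightarrow> norm (F x) \<le> C * \<bar>x\<bar> powr (- a)"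
  proof -
    have "0 < b" "b < 2 * pi" using \<nu>\<^sub>0 by (auto simp: b_def)
    from weighted_series_bound[OF a B bv this] that show thesis unfolding F_def by metis
  qed
  have x0: "((\<lambda>x. x powr a) \<longlongrightarrow> 0) (at_right 0)"
    using a by (intro tendsto_eq_intros) (auto simp: eventually_at_filter)
  have main: "((\<lambda>x. Re (of_real (x powr a) * F (s * x))) \<longlongrightarrow> Re (c * of_real (Gamma a) * cis (s * (pi * a / 2)))) (at_right 0)"
    unfolding F_def by (intro tendsto_Re weighted_series_asymptotics[OF a B bv lim s])
  \<comment> \<open>For 0 < x < r and both signs s, \<open>2 * \<nu>\<^sub>0 + s * x\<close> lies
    between \<open>\<nu>\<^sub>0\<close> and \<open>pi + \<nu>\<^sub>0\<close>.\<close>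
  define r where "r = min \<nu>\<^sub>0 (pi - \<nu>\<^sub>0)"
  have r: "0 < r" "r \<le> \<nu>\<^sub>0" "r \<le> pi - \<nu>\<^sub>0" using \<nu>\<^sub>0 by (auto simp: r_def)
  have other: "((\<lambda>x. x powr a * Re (F (- (2 * \<nu>\<^sub>0 + s * x)))) \<longlongrightarrow> 0) (at_right 0)"
  proof (rule Lim_null_comparison)
    show "((\<lambda>x. x powr a * (C * \<nu>\<^sub>0 powr (- a))) \<longlongrightarrow> 0) (at_right 0)"
      using tendsto_mult_left_zero[OF x0] .
    show "\<forall>\<^sub>F x in at_right 0. norm (x powr a * Re (F (- (2 * \<nu>\<^sub>0 + s * x)))) \<le> x powr a * (C * \<nu>\<^sub>0 powr (- a))"
      using eventually_at_right_real[OF r(1)]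
    proof eventually_elim
      case (elim x)
      have rng: "\<nu>\<^sub>0 \<le> 2 * \<nu>\<^sub>0 + s * x" "2 * \<nu>\<^sub>0 + s * x \<le> b" using elim s r \<nu>\<^sub>0 by (auto simp: b_def)
      then have "norm (F (- (2 * \<nu>\<^sub>0 + s * x))) \<le> C * \<bar>2 * \<nu>\<^sub>0 + s * x\<bar> powr (- a)"
        using C(2)[of "- (2 * \<nu>\<^sub>0 + s * x)"] \<nu>\<^sub>0 by (simp add: add.commute)
      also have "\<dots> \<le> C * \<nu>\<^sub>0 powr (- a)"
        using rng \<nu>\<^sub>0 a C(1) by (intro mult_left_mono powr_mono2') auto
      finally have "\<bar>Re (F (- (2 * \<nu>\<^sub>0 + s * x)))\<bar> \<le> C * \<nu>\<^sub>0 powr (- a)"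
        using abs_Re_le_cmod order_trans by blast
      then show ?case by (simp add: abs_mult mult_left_mono)
    qed
  qed
  have "((\<lambda>x. (x powr a * g + Re (of_real (x powr a) * F (s * x)) + x powr a * Re (F (- (2 * \<nu>\<^sub>0 + s * x)))) / (2 * pi))
      \<longlongrightarrow> (0 * g + Re (c * of_real (Gamma a) * cis (s * (pi * a / 2))) + 0) / (2 * pi)) (at_right 0)"
    by (intro tendsto_intros x0 main other) auto
  moreover have "x powr a * modulated_density g a m \<nu>\<^sub>0 (\<nu>\<^sub>0 + s * x) =
      (x powr a * g + Re (of_real (x powr a) * F (s * x)) + x powr a * Re (F (- (2 * \<nu>\<^sub>0 + s * x)))) / (2 * pi)" for x
  proof -
    have "\<nu>\<^sub>0 + s * x - \<nu>\<^sub>0 = s * x" "- (\<nu>\<^sub>0 + s * x + \<nu>\<^sub>0) = - (2 * \<nu>\<^sub>0 + s * x)" by simp_all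
    moreover have "Re (of_real r * w) = r * Re w" for r w by simp
    ultimately show ?thesis
      unfolding modulated_density_def F_def by (simp only: distrib_left times_divide_eq_right)
  qed
  moreover have "Re (c * of_real (Gamma a) * cis (s * (pi * a / 2))) = Gamma a * Re (c * cis (s * (pi * a / 2)))"
    by (simp add: algebra_simps)
  ultimately show ?thesis by simp
qed

text \<open>At the two singular points convergence of the series is not guaranteed; f receives the
  value 0 there, which keeps it nonnegative everywhere and does not affect integrals.\<close>

lemma spectral_density_modulated:
  fixes m :: "nat \<Rightarrow> complex"
  assumes X: "second_order_stationary M X"
    and a: "0 < a" "a < 1" and B: "\<And>h. norm (m h) \<le> B" and bv: "dyadic_bv m"
    and \<nu>\<^sub>0: "0 < \<nu>\<^sub>0" "\<nu>\<^sub>0 < pi"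
    and \<gamma>: "\<And>h. 1 \<le> h \<Longrightarrow> autocovariance M X (int h) = Re (weighted a m h * cis (- (real h * \<nu>\<^sub>0)))"
    and f: "f = (\<lambda>\<nu>. if \<nu> \<in> {-\<nu>\<^sub>0, \<nu>\<^sub>0} then 0 else modulated_density (autocovariance M X 0) a m \<nu>\<^sub>0 \<nu>)"
  shows "spectral_density (autocovariance M X) f"
    and "\<And>\<nu>. \<nu> \<in> {-pi..pi} - {-\<nu>\<^sub>0, \<nu>\<^sub>0} \<Longrightarrow> spectral_series_at (autocovariance M X) \<nu> (f \<nu>)"
proof -
  define g where "g = autocovariance M X"
  define T where "T N \<nu> = g 0 + 2 * (\<Sum>h<N. g (int (Suc h)) * cos (real (Suc h) * \<nu>))" for N \<nu>
  define S where "S N x = (\<Sum>h<N. weighted a m h * cis x ^ h)" for N x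
  define b where "b = pi + \<nu>\<^sub>0"
  have b: "0 < b" "b < 2 * pi" using \<nu>\<^sub>0 by (auto simp: b_def)
  have even: "g (- h) = g h" for h unfolding g_def by (rule autocovariance_minus[OF X])
  note sym_sum = symmetric_fourier_sum[of g, OF even, folded T_def]
  have T_eq: "T N \<nu> = g 0 + Re (S (Suc N) (\<nu> - \<nu>\<^sub>0)) + Re (S (Suc N) (- (\<nu> + \<nu>\<^sub>0)))" for N \<nu>
    unfolding T_def S_def by (rule modulated_fourier_sum[of g, OF even \<gamma>[folded g_def]])
  obtain C where C: "0 \<le> C"
    and summ: "\<And>x. x \<noteq> 0 \<Longrightarrow> \<bar>x\<bar> \<le> b \<Longrightarrow> summable (\<lambda>h. weighted a m h * cis x ^ h)"
    and S_bd: "\<And>N x. x \<noteq> 0 \<Longrightarrow> \<bar>x\<bar> \<le> b \<Longrightarrow> norm (S N x) \<le> C * \<bar>x\<bar> powr (- a)"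
    using weighted_series_bound[OF a B bv b] unfolding S_def by metis
  have rng: "\<nu> - \<nu>\<^sub>0 \<noteq> 0" "\<bar>\<nu> - \<nu>\<^sub>0\<bar> \<le> b" "- (\<nu> + \<nu>\<^sub>0) \<noteq> 0" "\<bar>- (\<nu> + \<nu>\<^sub>0)\<bar> \<le> b"
    if "\<nu> \<in> {-pi..pi} - {-\<nu>\<^sub>0, \<nu>\<^sub>0}" for \<nu>
    using that \<nu>\<^sub>0 by (auto simp: b_def)
  have T_lim: "(\<lambda>N. T N \<nu>) \<longlonglongrightarrow> 2 * pi * f \<nu>" if \<nu>: "\<nu> \<in> {-pi..pi} - {-\<nu>\<^sub>0, \<nu>\<^sub>0}" for \<nu>
  proof -
    have "(\<lambda>N. S (Suc N) x) \<longlonglongrightarrow> (\<Sum>h. weighted a m h * cis x ^ h)" if "x \<noteq> 0" "\<bar>x\<bar> \<le> b" for x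
      unfolding S_def by (intro LIMSEQ_Suc summable_LIMSEQ summ that)
    note S_lim = this
    have "2 * pi * f \<nu> = g 0 + Re (\<Sum>h. weighted a m h * cis (\<nu> - \<nu>\<^sub>0) ^ h)
        + Re (\<Sum>h. weighted a m h * cis (- (\<nu> + \<nu>\<^sub>0)) ^ h)"
      using \<nu> by (simp add: f modulated_density_def g_def)
    then show ?thesis unfolding T_eq using rng[OF \<nu>] by (auto intro!: tendsto_intros S_lim)
  qed
  show series: "spectral_series_at (autocovariance M X) \<nu> (f \<nu>)" if \<nu>: "\<nu> \<in> {-pi..pi} - {-\<nu>\<^sub>0, \<nu>\<^sub>0}" for \<nu>
  proof -
    have "(\<lambda>N. 1 / (2 * complex_of_real pi) * of_real (T N \<nu>)) \<longlonglongrightarrow> 1 / (2 * complex_of_real pi) * of_real (2 * pi * f \<nu>)"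
      by (intro tendsto_intros T_lim \<nu>)
    then show ?thesis unfolding spectral_series_at_def g_def[symmetric] sym_sum by simp
  qed
  have f_nn: "0 \<le> f \<nu>" if "\<nu> \<in> {-pi..pi}" for \<nu>
  proof (cases "\<nu> \<in> {-\<nu>\<^sub>0, \<nu>\<^sub>0}")
    case False
    have "0 \<le> (\<Sum>n<N. T n \<nu>)" for N
    proof -
      have "(\<Sum>n<N. T n \<nu>) = (\<Sum>j<N. \<Sum>k<N. g (int j - int k) * cos ((real j - real k) * \<nu>))"
        unfolding T_def by (rule Fejer_sum[of g, OF even, symmetric])
      \<comment> \<open>The addition formula for cos((j - k)\<nu>) splits the Fejer sum into two
        real quadratic forms, with cosine and sine weights.\<close>
      also have "\<dots> = (\<Sum>j<N. \<Sum>k<N. cos (real j * \<nu>) * cos (real k * \<nu>) * g (int j - int k))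
          + (\<Sum>j<N. \<Sum>k<N. sin (real j * \<nu>) * sin (real k * \<nu>) * g (int j - int k))"
        unfolding sum.distrib[symmetric] left_diff_distrib cos_diff by (intro sum.cong refl) (simp add: algebra_simps)
      also have "\<dots> \<ge> 0"
        unfolding g_def by (intro add_nonneg_nonneg autocovariance_quadratic_form_nonneg[OF X])
      finally show ?thesis .
    qed
    moreover have "(\<lambda>N. T N \<nu>) \<longlonglongrightarrow> 2 * pi * f \<nu>"
      using that False by (intro T_lim) blast
    ultimately have "0 \<le> 2 * pi * f \<nu>"
      by (rule limit_nonneg_if_Cesaro_nonneg[rotated])
    then show ?thesis using pi_gt_zero by (simp add: zero_le_mult_iff)
  qed (simp add: f)
  have cis_meas: "(\<lambda>\<nu>. cis (h \<nu>)) \<in> borel_measurable borel" if "continuous_on UNIV h" for h :: "real \<Rightarrow> real"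
    by (intro borel_measurable_continuous_onI continuous_intros that)
  have ser_meas: "(\<lambda>\<nu>. \<Sum>k. weighted a m k * cis (h \<nu>) ^ k) \<in> borel_measurable borel"
    if "continuous_on UNIV h" for h :: "real \<Rightarrow> real"
    using cis_meas[OF that] by measurable
  have "modulated_density (g 0) a m \<nu>\<^sub>0 \<in> borel_measurable borel"
    unfolding modulated_density_def[abs_def]
    by (intro borel_measurable_divide borel_measurable_add borel_measurable_const
        measurable_compose[OF ser_meas borel_measurable_Re] continuous_intros)
  then have f_meas: "f \<in> borel_measurable borel"
    unfolding f g_def by (intro measurable_If_set) auto
  define G where "G \<nu> = indicator {-pi..pi} \<nu> * \<bar>g 0\<bar> + C * (indicator {-b..b} (\<nu> - \<nu>\<^sub>0) * \<bar>\<nu> - \<nu>\<^sub>0\<bar> powr (- a))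
      + C * (indicator {-b..b} (\<nu> - (- \<nu>\<^sub>0)) * \<bar>\<nu> - (- \<nu>\<^sub>0)\<bar> powr (- a))" for \<nu> :: real
  have G_int: "integrable lborel G"
    unfolding G_def using a b
    by (intro Bochner_Integration.integrable_add integrable_mult_right integrable_abs_powr_interval integrable_mult_left integrable_real_indicator) auto
  have G_bd: "norm (\<Sum>k\<in>{- int N..int N}. cis (- (of_int k * \<nu>)) * complex_of_real (g k)) \<le> G \<nu>"
    if \<nu>: "\<nu> \<in> {-pi..pi} - {-\<nu>\<^sub>0, \<nu>\<^sub>0}" for \<nu> N
  proof -
    note r = rng[OF \<nu>]
    have "\<bar>T N \<nu>\<bar> \<le> \<bar>g 0\<bar> + norm (S (Suc N) (\<nu> - \<nu>\<^sub>0)) + norm (S (Suc N) (- (\<nu> + \<nu>\<^sub>0)))"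
      unfolding T_eq
      using abs_Re_le_cmod[of "S (Suc N) (\<nu> - \<nu>\<^sub>0)"] abs_Re_le_cmod[of "S (Suc N) (- (\<nu> + \<nu>\<^sub>0))"] by linarith
    also have "\<dots> \<le> \<bar>g 0\<bar> + C * \<bar>\<nu> - \<nu>\<^sub>0\<bar> powr (- a) + C * \<bar>- (\<nu> + \<nu>\<^sub>0)\<bar> powr (- a)"
      by (intro add_mono S_bd r order_refl)
    also have "\<dots> = G \<nu>"
    proof -
      have "\<nu> - \<nu>\<^sub>0 \<in> {-b..b}" "\<nu> - (- \<nu>\<^sub>0) \<in> {-b..b}" "\<bar>- (\<nu> + \<nu>\<^sub>0)\<bar> = \<bar>\<nu> - (- \<nu>\<^sub>0)\<bar>" "\<nu> \<in> {-pi..pi}"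
        using r \<nu> by (auto simp: abs_le_iff)
      then show ?thesis unfolding G_def by (simp only: indicator_simps mult_1)
    qed
    finally show ?thesis unfolding sym_sum by simp
  qed
  show "spectral_density (autocovariance M X) f"
    using even f_meas f_nn series G_int G_bd
    by (intro spectral_density_dominated[of _ f "{-\<nu>\<^sub>0, \<nu>\<^sub>0}" G]) (auto simp: g_def)
qed

section \<open>Assembly: the coefficients built from L1 and L2\<close>

theorem propositionC1:
  fixes M :: "'a measure" and X :: "int \<Rightarrow> 'a \<Rightarrow> real"
    and \<nu>\<^sub>0 d c\<^sub>\<gamma> \<phi> :: real
    and L1 L2 :: "real \<Rightarrow> real" and R\<^sub>\<gamma> :: "int \<Rightarrow> real"
  assumes "0 < \<nu>\<^sub>0" and "\<nu>\<^sub>0 < pi"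
    and "0 < d" and "d < 1/2"
    and "0 < c\<^sub>\<gamma>"
    and "(d - 1/2) * pi < \<phi>" and "\<phi> < (1/2 - d) * pi"
    and "second_order_stationary M X"
    and "\<And>h. h \<ge> 1 \<Longrightarrow> autocovariance M X h =
           (c\<^sub>\<gamma> * cos (\<nu>\<^sub>0 * real_of_int h + \<phi>) + R\<^sub>\<gamma> h) * real_of_int h powr (2 * d - 1)"
    and "\<And>h. h \<ge> 1 \<Longrightarrow> R\<^sub>\<gamma> h =
           (L1 (real_of_int h) - c\<^sub>\<gamma> * cos \<phi>) * cos (\<nu>\<^sub>0 * real_of_int h)
           + sgn (- sin \<phi>) * (L2 (real_of_int h) - \<bar>c\<^sub>\<gamma> * sin \<phi>\<bar>) * sin (\<nu>\<^sub>0 * real_of_int h)"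
    and "quasi_monotone L1" and "quasi_monotone L2"
    and "(L1 \<longlongrightarrow> c\<^sub>\<gamma> * cos \<phi>) at_top"
    and "\<phi> \<noteq> 0 \<Longrightarrow> (L2 \<longlongrightarrow> \<bar>c\<^sub>\<gamma> * sin \<phi>\<bar>) at_top"
  shows "\<exists>f Rm Rp.
      spectral_density (autocovariance M X) f \<and>
      (\<forall>\<nu>\<in>{-pi..pi} - {-\<nu>\<^sub>0, \<nu>\<^sub>0}. spectral_series_at (autocovariance M X) \<nu> (f \<nu>)) \<and>
      (\<forall>\<nu>\<in>{0<..<\<nu>\<^sub>0}. f \<nu> =
         (c\<^sub>\<gamma> / (2 * pi) * Gamma (2 * d) * cos (pi * d + \<phi>) + Rm (\<nu>\<^sub>0 - \<nu>))
         * (\<nu>\<^sub>0 - \<nu>) powr (- 2 * d)) \<and>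
      (\<forall>\<nu>\<in>{\<nu>\<^sub>0<..<pi}. f \<nu> =
         (c\<^sub>\<gamma> / (2 * pi) * Gamma (2 * d) * cos (pi * d - \<phi>) + Rp (\<nu> - \<nu>\<^sub>0))
         * (\<nu> - \<nu>\<^sub>0) powr (- 2 * d)) \<and>
      (Rm \<longlongrightarrow> 0) (at_right 0) \<and> (Rp \<longlongrightarrow> 0) (at_right 0)"
proof -
  note \<nu>\<^sub>0 = assms(1,2) and X = assms(8) and \<gamma>_form = assms(9) and R_form = assms(10)
  define a where "a = 2 * d"
  have a: "0 < a" "a < 1" using assms(3,4) by (auto simp: a_def)
  define \<sigma> where "\<sigma> = sgn (- sin \<phi>)"
  \<comment> \<open>The real part of m_h times \<open>cis (- (real h * \<nu>\<^sub>0))\<close> is L1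
    times the cosine plus \<sigma> L2 times the sine.\<close>
  define m where "m h = complex_of_real (L1 (real h)) + \<i> * of_real \<sigma> * complex_of_real (L2 (real h))" for h :: nat
  have lim1: "(\<lambda>h. complex_of_real (L1 (real h))) \<longlonglongrightarrow> of_real (c\<^sub>\<gamma> * cos \<phi>)"
    by (intro tendsto_of_real filterlim_compose[OF assms(13) filterlim_real_sequentially])
  have bv1: "dyadic_bv (\<lambda>h. complex_of_real (L1 (real h)))"
    by (rule quasi_monotone_dyadic_bv[OF assms(11,13)])
  have second: "dyadic_bv (\<lambda>h. \<i> * of_real \<sigma> * complex_of_real (L2 (real h))) \<and>
      (\<lambda>h. \<i> * of_real \<sigma> * complex_of_real (L2 (real h))) \<longlonglongrightarrow> \<i> * of_real \<sigma> * of_real \<bar>c\<^sub>\<gamma> * sin \<phi>\<bar>"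
  proof (cases "\<phi> = 0")
    \<comment> \<open>No limit of L2 is assumed when \<phi> = 0, but then \<sigma> = 0 and this
      component vanishes identically.\<close>
    case True
    then show ?thesis by (auto simp: \<sigma>_def dyadic_bv_def)
  next
    case False
    show ?thesis
      by (intro conjI dyadic_bv_mult quasi_monotone_dyadic_bv[OF assms(12) assms(14)[OF False]] tendsto_intros
          filterlim_compose[OF assms(14)[OF False] filterlim_real_sequentially])
  qed
  have bv: "dyadic_bv m"
    unfolding m_def[abs_def] using bv1 second by (intro dyadic_bv_add) auto
  have "m \<longlonglongrightarrow> of_real (c\<^sub>\<gamma> * cos \<phi>) + \<i> * of_real \<sigma> * of_real \<bar>c\<^sub>\<gamma> * sin \<phi>\<bar>"
    unfolding m_def[abs_def] using lim1 second by (intro tendsto_add) auto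
  \<comment> \<open>The sign \<sigma> undoes the absolute value: \<sigma> |sin \<phi>| = - sin
    \<phi>.\<close>
  also have "of_real (c\<^sub>\<gamma> * cos \<phi>) + \<i> * of_real \<sigma> * of_real \<bar>c\<^sub>\<gamma> * sin \<phi>\<bar> = c\<^sub>\<gamma> * cis (- \<phi>)"
    using assms(5) by (simp add: complex_eq_iff \<sigma>_def abs_mult sgn_if)
  finally have lim: "m \<longlonglongrightarrow> c\<^sub>\<gamma> * cis (- \<phi>)" .
  obtain B where B: "\<And>h. norm (m h) \<le> B"
    using convergent_imp_Bseq[OF convergentI[OF lim]] unfolding Bseq_def by blast
  have \<gamma>: "autocovariance M X (int h) = Re (weighted a m h * cis (- (real h * \<nu>\<^sub>0)))" if h: "1 \<le> h" for h
  proof -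
    have "sgn (- sin \<phi>) * \<bar>sin \<phi>\<bar> = - sin \<phi>" by (simp add: sgn_if)
    then have abs: "\<sigma> * \<bar>c\<^sub>\<gamma> * sin \<phi>\<bar> = - (c\<^sub>\<gamma> * sin \<phi>)"
      using assms(5) by (simp add: \<sigma>_def abs_mult mult.left_commute)
    \<comment> \<open>The constants subtracted inside \<open>R\<^sub>\<gamma>\<close> cancel the
      expanded cosine, leaving only the terms with L1 and L2; the last summand is zero by
      \<open>abs\<close>.\<close>
    have "c\<^sub>\<gamma> * cos (\<nu>\<^sub>0 * real h + \<phi>) + R\<^sub>\<gamma> (int h) =
        L1 (real h) * cos (\<nu>\<^sub>0 * real h) + \<sigma> * L2 (real h) * sin (\<nu>\<^sub>0 * real h)
        - (c\<^sub>\<gamma> * sin \<phi> + \<sigma> * \<bar>c\<^sub>\<gamma> * sin \<phi>\<bar>) * sin (\<nu>\<^sub>0 * real h)"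
      using R_form[of "int h", folded \<sigma>_def] h by (simp add: cos_add algebra_simps)
    also have "\<dots> = Re (m h * cis (- (real h * \<nu>\<^sub>0)))"
      unfolding abs by (simp add: m_def mult.commute)
    finally show ?thesis
      using \<gamma>_form[of "int h"] h by (simp add: weighted_def a_def algebra_simps)
  qed
  define D where "D = modulated_density (autocovariance M X 0) a m \<nu>\<^sub>0"
  define f where "f = (\<lambda>\<nu>. if \<nu> \<in> {-\<nu>\<^sub>0, \<nu>\<^sub>0} then 0 else D \<nu>)"
  note spec = spectral_density_modulated[OF X a B bv \<nu>\<^sub>0 \<gamma> f_def[unfolded D_def]]
  define cm where "cm = c\<^sub>\<gamma> / (2 * pi) * Gamma (2 * d) * cos (pi * d + \<phi>)"
  define cp where "cp = c\<^sub>\<gamma> / (2 * pi) * Gamma (2 * d) * cos (pi * d - \<phi>)"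
  \<comment> \<open>The remainders are obtained by solving the required representation for them. The
    unsimplified factors -1 and 1 match the parameter s of the asymptotic lemma.\<close>
  define Rm where "Rm x = x powr a * D (\<nu>\<^sub>0 + (- 1) * x) - cm" for x
  define Rp where "Rp x = x powr a * D (\<nu>\<^sub>0 + 1 * x) - cp" for x
  have Re_lim: "Gamma a * Re (of_real c\<^sub>\<gamma> * cis (- \<phi>) * cis (s * (pi * a / 2))) / (2 * pi)
      = c\<^sub>\<gamma> / (2 * pi) * Gamma (2 * d) * cos (s * (pi * d) - \<phi>)" for s
    by (simp add: cis_mult mult.assoc a_def)
  have "(Rm \<longlongrightarrow> 0) (at_right 0)"
  proof -
    have "((\<lambda>x. x powr a * D (\<nu>\<^sub>0 + (- 1) * x)) \<longlongrightarrow> c\<^sub>\<gamma> / (2 * pi) * Gamma (2 * d) * cos ((- 1) * (pi * d) - \<phi>)) (at_right 0)"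
      unfolding D_def Re_lim[symmetric] by (intro modulated_density_asymptotics[OF a B bv lim _ \<nu>\<^sub>0]) simp
    moreover have "cos ((- 1) * (pi * d) - \<phi>) = cos (pi * d + \<phi>)"
      using cos_minus[of "pi * d + \<phi>"] by simp
    ultimately show ?thesis unfolding Rm_def[abs_def] cm_def by (simp only: LIM_zero)
  qed
  moreover have "(Rp \<longlongrightarrow> 0) (at_right 0)"
  proof -
    have "((\<lambda>x. x powr a * D (\<nu>\<^sub>0 + 1 * x)) \<longlongrightarrow> c\<^sub>\<gamma> / (2 * pi) * Gamma (2 * d) * cos (1 * (pi * d) - \<phi>)) (at_right 0)"
      unfolding D_def Re_lim[symmetric] by (intro modulated_density_asymptotics[OF a B bv lim _ \<nu>\<^sub>0]) simp
    then show ?thesis unfolding Rp_def[abs_def] cp_def by (simp only: LIM_zero mult_1)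
  qed
  moreover have cancel: "(x powr a * y) * x powr (- 2 * d) = y" if "0 < x" for x y :: real
    using that by (simp add: a_def powr_minus)
  have "f \<nu> = (cm + Rm (\<nu>\<^sub>0 - \<nu>)) * (\<nu>\<^sub>0 - \<nu>) powr (- 2 * d)" if "\<nu> \<in> {0<..<\<nu>\<^sub>0}" for \<nu>
    using that cancel[of "\<nu>\<^sub>0 - \<nu>" "D \<nu>"] by (simp add: Rm_def f_def)
  moreover have "f \<nu> = (cp + Rp (\<nu> - \<nu>\<^sub>0)) * (\<nu> - \<nu>\<^sub>0) powr (- 2 * d)" if "\<nu> \<in> {\<nu>\<^sub>0<..<pi}" for \<nu>
    using that \<nu>\<^sub>0 cancel[of "\<nu> - \<nu>\<^sub>0" "D \<nu>"] by (simp add: Rp_def f_def)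
  ultimately show ?thesis
    using spec unfolding cm_def cp_def by (intro exI[of _ f] exI[of _ Rm] exI[of _ Rp] conjI ballI)
qed

end
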